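(* Let $R$ be a field, $\delta\in R$, and let $n\ge r>s\ge0$ be integers of the same parity. Then the $R$-vector space $\operatorname{Hom}_{\mathrm{TL}_n}(S(n,r),S(n,s))$ is at most one-dimensional.
   Context: For $n,m\in\mathbb{N}$ of the same parity, an $(n,m)$-diagram is a pairing of $n+m$ points ($n$ source sites in a left vertical column, $m$ target sites in a right vertical column) by $(n+m)/2$ non-crossing lines in the strip between the columns, up to deformation fixing endpoints. $\operatorname{Hom}(\underline n,\underline m)$ is the free $R$-module on $(n,m)$-diagrams. Composites are written left to right: $xy$ is obtained by placing $x$ to the left of $y$, identifying the middle points and replacing each closed loop by a factor $\delta$. $\mathrm{TL}_n=\mathrm{TL}_n^R(\delta)=\operatorname{End}(\underline n)$. For $m\le n$ an $(n,m)$-diagram is monic if every target site is joined to a source site. The cell module $S(n,m)$ has basis the monic $(n,m)$-diagrams, with $a\in\mathrm{TL}_n$ acting by $x\mapsto ax$ and every resulting non-monic diagram set to $0$. *)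

theory Defs
  imports Complex_Main "HOL-Library.Disjoint_Sets" "HOL-Library.Function_Algebras"
begin

section \<open>Diagrams\<close>

datatype site = Src nat | Tgt nat

definition sites :: "nat \<Rightarrow> nat \<Rightarrow> site set" where
  "sites n m = Src ` {..<n} \<union> Tgt ` {..<m}"

text \<open>
  Both columns are numbered from top to bottom, starting with 0.  Walking around the boundary of
  the strip one meets the source sites downwards and then the target sites upwards; \<open>bpos\<close> is the
  position of a site on this walk.
\<close>

fun bpos :: "nat \<Rightarrow> nat \<Rightarrow> site \<Rightarrow> nat" where
  "bpos n m (Src i) = i"
| "bpos n m (Tgt j) = n + (m - 1 - j)"

text \<open>
  Up to deformation fixing the endpoints, a system of disjoint lines in the strip is determined by
  the pairing of its endpoints, and a pairing is realised by disjoint lines iff no two of its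
  pairs interleave along the boundary.  For \<open>n + m\<close> odd, \<open>diagrams n m\<close> is empty.
\<close>

type_synonym diagram = "site set set"

definition diagrams :: "nat \<Rightarrow> nat \<Rightarrow> diagram set" where
  "diagrams n m = {D. partition_on (sites n m) D \<and> (\<forall>p\<in>D. card p = 2) \<and>
     \<not> (\<exists>a b c d. {a, b} \<in> D \<and> {c, d} \<in> D \<and>
          bpos n m a < bpos n m c \<and> bpos n m c < bpos n m b \<and> bpos n m b < bpos n m d)}"

definition monic_diagrams :: "nat \<Rightarrow> nat \<Rightarrow> diagram set" where
  "monic_diagrams n m = {D \<in> diagrams n m. \<forall>j<m. \<exists>i<n. {Src i, Tgt j} \<in> D}"


section \<open>Composition of diagrams\<close>

text \<open>
  Placing an \<open>(n,m)\<close>-diagram \<open>D\<close> to the left of an \<open>(m,k)\<close>-diagram \<open>E\<close> and identifying the targets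
  of \<open>D\<close> with the sources of \<open>E\<close> gives a graph on three columns of nodes.
\<close>

datatype node = LeftNode nat | MidNode nat | RightNode nat

fun left_node :: "site \<Rightarrow> node" where
  "left_node (Src i) = LeftNode i"
| "left_node (Tgt j) = MidNode j"

fun right_node :: "site \<Rightarrow> node" where
  "right_node (Src i) = MidNode i"
| "right_node (Tgt j) = RightNode j"

fun outer_node :: "site \<Rightarrow> node" where
  "outer_node (Src i) = LeftNode i"
| "outer_node (Tgt j) = RightNode j"

definition glued_edges :: "diagram \<Rightarrow> diagram \<Rightarrow> node set set" where
  "glued_edges D E = (\<lambda>p. left_node ` p) ` D \<union> (\<lambda>p. right_node ` p) ` E"

definition glued_components :: "diagram \<Rightarrow> diagram \<Rightarrow> node set set" where
  "glued_components D E = \<Union>(glued_edges D E) // {(u, v). {u, v} \<in> glued_edges D E}\<^sup>*"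

text \<open>
  A component is either a path, whose two ends are outer nodes and which becomes a line of the
  composite, or a closed loop, all of whose nodes lie in the middle column.
\<close>

definition compose_diagram :: "diagram \<Rightarrow> diagram \<Rightarrow> diagram" where
  "compose_diagram D E = (\<lambda>C. outer_node -` C) ` glued_components D E - {{}}"

definition loops :: "diagram \<Rightarrow> diagram \<Rightarrow> nat" where
  "loops D E = card {C \<in> glued_components D E. outer_node -` C = {}}"


section \<open>Temperley--Lieb algebras and cell modules\<close>

text \<open>
  The free module on a finite set of diagrams consists of the coefficient functions vanishing
  off that set, with pointwise operations.
\<close>

definition free_on :: "diagram set \<Rightarrow> (diagram \<Rightarrow> 'r::field) set" where
  "free_on A = {x. \<forall>D. D \<notin> A \<longrightarrow> x D = 0}"

definition scale :: "'r::field \<Rightarrow> (diagram \<Rightarrow> 'r) \<Rightarrow> diagram \<Rightarrow> 'r" where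
  "scale c x = (\<lambda>D. c * x D)"

definition dhom :: "nat \<Rightarrow> nat \<Rightarrow> (diagram \<Rightarrow> 'r::field) set" where
  "dhom n m = free_on (diagrams n m)"

definition compose ::
    "'r::field \<Rightarrow> nat \<Rightarrow> nat \<Rightarrow> nat \<Rightarrow> (diagram \<Rightarrow> 'r) \<Rightarrow> (diagram \<Rightarrow> 'r) \<Rightarrow> diagram \<Rightarrow> 'r" where
  "compose \<delta> n m k x y = (\<lambda>F. \<Sum>D\<in>diagrams n m. \<Sum>E\<in>diagrams m k.
     if compose_diagram D E = F then x D * y E * \<delta> ^ loops D E else 0)"

text \<open>The underlying set of the algebra; its multiplication is \<open>compose \<delta> n n n\<close>.\<close>

definition TL :: "nat \<Rightarrow> (diagram \<Rightarrow> 'r::field) set" where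
  "TL n = dhom n n"

definition cell_module :: "nat \<Rightarrow> nat \<Rightarrow> (diagram \<Rightarrow> 'r::field) set" where
  "cell_module n m = free_on (monic_diagrams n m)"

definition cell_act ::
    "'r::field \<Rightarrow> nat \<Rightarrow> nat \<Rightarrow> (diagram \<Rightarrow> 'r) \<Rightarrow> (diagram \<Rightarrow> 'r) \<Rightarrow> diagram \<Rightarrow> 'r" where
  "cell_act \<delta> n m a x = (\<lambda>F. if F \<in> monic_diagrams n m then compose \<delta> n n m a x F else 0)"


section \<open>Homomorphisms of cell modules\<close>

text \<open>
  A map is only relevant on \<open>cell_module n r\<close>; requiring it to vanish elsewhere makes equality
  of functions coincide with equality of homomorphisms.
\<close>

definition cell_hom ::
    "'r::field \<Rightarrow> nat \<Rightarrow> nat \<Rightarrow> nat \<Rightarrow> ((diagram \<Rightarrow> 'r) \<Rightarrow> diagram \<Rightarrow> 'r) set" where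
  "cell_hom \<delta> n r s = {\<phi>.
     (\<forall>x\<in>cell_module n r. \<phi> x \<in> cell_module n s) \<and>
     (\<forall>x\<in>cell_module n r. \<forall>y\<in>cell_module n r. \<phi> (x + y) = \<phi> x + \<phi> y) \<and>
     (\<forall>c. \<forall>x\<in>cell_module n r. \<phi> (scale c x) = scale c (\<phi> x)) \<and>
     (\<forall>a\<in>TL n. \<forall>x\<in>cell_module n r. \<phi> (cell_act \<delta> n r a x) = cell_act \<delta> n s a (\<phi> x)) \<and>
     (\<forall>x. x \<notin> cell_module n r \<longrightarrow> \<phi> x = 0)}"

definition hom_scale ::
    "'r::field \<Rightarrow> ((diagram \<Rightarrow> 'r) \<Rightarrow> diagram \<Rightarrow> 'r) \<Rightarrow> (diagram \<Rightarrow> 'r) \<Rightarrow> diagram \<Rightarrow> 'r" where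
  "hom_scale c \<phi> = (\<lambda>x. scale c (\<phi> x))"

interpretation hom_vs: vector_space hom_scale
  by unfold_locales
    (auto simp: hom_scale_def scale_def fun_eq_iff plus_fun_def algebra_simps)

lemma cell_act_add: "cell_act \<delta> n m a (x + y) = cell_act \<delta> n m a x + cell_act \<delta> n m a y"
proof -
  have "compose \<delta> n n m a (x + y) F = compose \<delta> n n m a x F + compose \<delta> n n m a y F" for F
    unfolding compose_def sum.distrib[symmetric]
    by (intro sum.cong refl) (auto simp: algebra_simps)
  then show ?thesis by (auto simp: cell_act_def fun_eq_iff)
qed

lemma cell_act_scale: "cell_act \<delta> n m a (scale c x) = scale c (cell_act \<delta> n m a x)"
proof -
  have "compose \<delta> n n m a (scale c x) F = c * compose \<delta> n n m a x F" for F
    unfolding compose_def sum_distrib_left scale_def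
    by (intro sum.cong refl) (auto simp: algebra_simps)
  then show ?thesis by (auto simp: cell_act_def scale_def fun_eq_iff)
qed

lemma subspace_cell_hom: "hom_vs.subspace (cell_hom \<delta> n r s)"
proof -
  have zero: "cell_act \<delta> n m a 0 = 0" for m a
    using cell_act_add[of \<delta> n m a 0 0] by simp
  show ?thesis
    unfolding hom_vs.subspace_def
  proof (intro conjI ballI allI)
    show "0 \<in> cell_hom \<delta> n r s"
      by (simp add: cell_hom_def zero cell_module_def free_on_def) (simp add: scale_def fun_eq_iff)
  next
    fix f g assume "f \<in> cell_hom \<delta> n r s" "g \<in> cell_hom \<delta> n r s"
    then show "f + g \<in> cell_hom \<delta> n r s"
      unfolding cell_hom_def
      by (auto simp: cell_act_add cell_module_def free_on_def)
        (auto simp: scale_def fun_eq_iff algebra_simps)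
  next
    fix c f assume "f \<in> cell_hom \<delta> n r s"
    then show "hom_scale c f \<in> cell_hom \<delta> n r s"
      unfolding cell_hom_def hom_scale_def
      by (auto simp: cell_act_scale cell_module_def free_on_def)
        (auto simp: scale_def fun_eq_iff algebra_simps)
  qed
qed

end

theory Submission
  imports Defs
begin

text \<open>
  Numbering the boundary points \<open>0, \<dots>, n + m - 1\<close> (sources downwards, then targets
  upwards) turns an \<open>(n,m)\<close>-diagram into a non-crossing involution \<open>f\<close> without
  fixed points; it is monic iff every target position has a source as its partner. Left multiplication
  by the generator \<open>U\<^sub>i\<close> of \<open>TL\<^sub>n\<close> is a surgery: it joins
  \<open>i\<close> with \<open>i + 1\<close>, and their former partners with each other. The result is
  non-monic exactly when both former partners are targets, and a loop arises only when \<open>i\<close>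
  and \<open>i + 1\<close> were joined already. The argument uses these generators only.

  A homomorphism \<open>\<phi>\<close> is determined by one vector. Let \<open>e\<close> be the diagram
  with \<open>c\<close> small cups on the sources \<open>0, \<dots>, 2c - 1\<close> and
  \<open>r > 0\<close> through lines below them. Every other monic \<open>(n,r)\<close>-diagram has a
  small cup directly below a source that is joined further down or to a target; sliding the cup one step
  up gives a simpler diagram, and a generator undoes the slide without creating a loop
  (\<open>untangle\<close>). So \<open>e\<close> generates \<open>S(n,r)\<close>, for every value of
  \<open>\<delta>\<close> (\<open>cell_hom_determined\<close>).

  The vector \<open>v = \<phi> e\<close> is heavily constrained. Because \<open>r > 0\<close>, there is
  a source below each of the cups of \<open>e\<close>, so that
  \<open>U\<^sub>2\<^sub>j U\<^sub>2\<^sub>j\<^sub>+\<^sub>1 e = e\<close> for \<open>j < c\<close>;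
  hence \<open>v\<close> is supported on diagrams containing the same cups. And
  \<open>U\<^sub>q e = 0\<close> for \<open>q \<ge> 2c\<close>, hence \<open>U\<^sub>q v = 0\<close>.

  Such a vector is determined by a single coefficient. Call a source whose partner lies above it a
  closer, and weigh a diagram by reading its set of closers as a binary number. Suppose that the
  heaviest diagram \<open>f\<close> in the support of \<open>v\<close> has a closer
  \<open>q \<ge> 2c\<close> followed by a source that is not a closer. Every other diagram with the same
  image under \<open>U\<^sub>q\<close> is heavier than \<open>f\<close>
  (\<open>surgery_fibre_weight\<close>), so the coefficient of \<open>U\<^sub>q v = 0\<close> at that
  image is the coefficient of \<open>v\<close> at \<open>f\<close>, a contradiction. Hence the closers
  of \<open>f\<close> below the first \<open>c\<close> cups are the last sources, and there is at most
  one such diagram (\<open>leading_unique\<close>), because a monic diagram is determined by its closers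
  and their number is fixed. Two non-zero homomorphisms therefore have a non-zero coefficient at the
  same diagram, and a suitable linear combination of them vanishes.
\<close>


section \<open>Non-crossing matchings\<close>

text \<open>
  Requiring fixed points off \<open>{..<N}\<close> makes the function unique. The last clause is the
  non-crossing condition in its most usable form: the interval under an arc is closed under
  \<open>f\<close>.
\<close>

definition nc_matchings :: "nat \<Rightarrow> (nat \<Rightarrow> nat) set" where
  "nc_matchings N = {f. (\<forall>p. f (f p) = p) \<and> (\<forall>p. f p \<noteq> p \<longleftrightarrow> p < N) \<and>
     (\<forall>p q. p < q \<and> q < f p \<longrightarrow> p < f q \<and> f q < f p)}"

lemma ncm_invol: "f \<in> nc_matchings N \<Longrightarrow> f (f p) = p"
  and ncm_neq: "f \<in> nc_matchings N \<Longrightarrow> f p \<noteq> p \<longleftrightarrow> p < N"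
  and ncm_nested: "f \<in> nc_matchings N \<Longrightarrow> p < q \<Longrightarrow> q < f p \<Longrightarrow> p < f q \<and> f q < f p"
  by (auto simp: nc_matchings_def)

lemma ncm_less: "f \<in> nc_matchings N \<Longrightarrow> f p < N \<longleftrightarrow> p < N"
  by (metis ncm_invol ncm_neq)

text \<open>
  This is the uniqueness of bracket matching: going through the closers from left to right, the partner
  of each is the nearest opener not yet used. If \<open>f\<close> and \<open>g\<close> first disagreed
  at \<open>j\<close>, the inner one of the two partners would be matched by the other function to a
  closer before \<open>j\<close>, where both agree.
\<close>

lemma ncm_eq_of_closers:
  assumes f: "f \<in> nc_matchings N" and g: "g \<in> nc_matchings N" and eq: "\<And>p. f p < p \<longleftrightarrow> g p < p"
  shows "f = g"
proof -
  have closer: "f j = g j" if "f j < j" for j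
    using that
  proof (induction j rule: less_induct)
    case (less j)
    have gj: "g j < j" using less.prems eq by blast
    have "\<not> f j < g j"
    proof
      assume lt: "f j < g j"
      have 1: "f j < f (g j)" "f (g j) < j"
        using ncm_nested[OF f lt] ncm_invol[OF f, of j] gj by auto
      have "\<not> g (g j) < g j" using ncm_invol[OF g, of j] gj by simp
      then have "\<not> f (g j) < g j" using eq by blast
      moreover have "f (g j) \<noteq> g j" using gj f g less.prems
        by (metis ncm_less ncm_neq nat_neq_iff)
      ultimately have "f (f (g j)) < f (g j)" using ncm_invol[OF f] by simp
      then have "f (f (g j)) = g (f (g j))" using less.IH 1 by blast
      then show False using ncm_invol[OF f] ncm_invol[OF g] 1 by (metis less_irrefl)
    qed
    moreover have "\<not> g j < f j"
    proof
      assume lt: "g j < f j"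
      have 1: "g j < g (f j)" "g (f j) < j"
        using ncm_nested[OF g lt] ncm_invol[OF g, of j] less.prems by auto
      have "\<not> f (f j) < f j" using ncm_invol[OF f, of j] less.prems by simp
      then have "\<not> g (f j) < f j" using eq by blast
      moreover have "g (f j) \<noteq> f j" using gj f g less.prems
        by (metis ncm_less ncm_neq nat_neq_iff)
      ultimately have "g (g (f j)) < g (f j)" using ncm_invol[OF g] by simp
      then have "f (g (f j)) = g (g (f j))" using less.IH 1 eq by blast
      then show False using ncm_invol[OF f] ncm_invol[OF g] 1 by (metis less_irrefl)
    qed
    ultimately show ?case by simp
  qed
  have "f p = g p" for p
  proof (cases "f p" p rule: linorder_cases)
    case less then show ?thesis by (rule closer)
  next
    case equal then show ?thesis using ncm_neq[OF f, of p] ncm_neq[OF g, of p] by auto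
  next
    case greater
    then have "f (f p) = g (f p)" using closer[of "f p"] ncm_invol[OF f] by simp
    then show ?thesis using ncm_invol[OF f] ncm_invol[OF g] by metis
  qed
  then show ?thesis by blast
qed

lemma ncm_card_closers:
  assumes f: "f \<in> nc_matchings N"
  shows "2 * card {p. f p < p} = N"
proof -
  have sub: "{p. f p < p} \<subseteq> {..<N}" "{p. p < f p} \<subseteq> {..<N}"
  proof -
    have "p < N" if "f p < p \<or> p < f p" for p
      using that ncm_neq[OF f, of p] by linarith
    then show "{p. f p < p} \<subseteq> {..<N}" "{p. p < f p} \<subseteq> {..<N}" by blast+
  qed
  have "bij_betw f {p. f p < p} {p. p < f p}"
    by (rule bij_betw_byWitness[where f' = f]) (auto simp: ncm_invol[OF f])
  then have eq: "card {p. f p < p} = card {p. p < f p}"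
    by (rule bij_betw_same_card)
  have "{..<N} = {p. f p < p} \<union> {p. p < f p}"
  proof (rule set_eqI)
    fix p
    show "p \<in> {..<N} \<longleftrightarrow> p \<in> {p. f p < p} \<union> {p. p < f p}"
      using ncm_neq[OF f, of p] by auto
  qed
  then have "N = card ({p. f p < p} \<union> {p. p < f p})" by (metis card_lessThan)
  also have "\<dots> = card {p. f p < p} + card {p. p < f p}"
    using sub by (intro card_Un_disjoint) (auto intro: finite_subset)
  finally show ?thesis using eq by simp
qed

section \<open>Surgery on neighbouring points\<close>

text \<open>
  The partners of \<open>i\<close> and \<open>Suc i\<close> are joined first, so that the updates at
  \<open>i\<close> and \<open>Suc i\<close> override them and nothing changes when \<open>i\<close> and
  \<open>Suc i\<close> are partners already.
\<close>

definition surgery :: "nat \<Rightarrow> (nat \<Rightarrow> nat) \<Rightarrow> nat \<Rightarrow> nat" where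
  "surgery i f = f(f i := f (Suc i), f (Suc i) := f i, i := Suc i, Suc i := i)"

lemma surgery_cup: "f i = Suc i \<Longrightarrow> f (Suc i) = i \<Longrightarrow> surgery i f = f"
  by (auto simp: surgery_def fun_eq_iff)

lemma surgery_simps [simp]: "surgery i f i = Suc i" "surgery i f (Suc i) = i"
  by (auto simp: surgery_def)

lemma surgery_other:
  assumes "f \<in> nc_matchings N" "p \<noteq> i" "p \<noteq> Suc i" "f p \<noteq> i" "f p \<noteq> Suc i"
  shows "surgery i f p = f p"
  using assms(2-5) ncm_invol[OF assms(1), of i] ncm_invol[OF assms(1), of "Suc i"]
  by (auto simp: surgery_def)

lemma surgery_partner:
  assumes "f \<in> nc_matchings N" "f i \<noteq> Suc i"  "Suc i < N"
  shows "surgery i f (f i) = f (Suc i)" "surgery i f (f (Suc i)) = f i"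
proof -
  have "f i \<noteq> i" "f (Suc i) \<noteq> Suc i" "f (Suc i) \<noteq> i" "f (Suc i) \<noteq> f i"
    using assms ncm_neq[OF assms(1)] ncm_invol[OF assms(1)] by (metis Suc_lessD Suc_n_not_n)+
  then show "surgery i f (f i) = f (Suc i)" "surgery i f (f (Suc i)) = f i"
    using assms(2) by (auto simp: surgery_def)
qed

text \<open>
  An arc avoiding \<open>i\<close> and \<open>Suc i\<close> has these two neighbours on the same side,
  and each of them is on the same side as its partner; so both former partners are on one side and may
  be joined without crossing it.
\<close>

lemma surgery_nc_matching:
  assumes f: "f \<in> nc_matchings N" and i: "Suc i < N"
  shows "surgery i f \<in> nc_matchings N"
proof (cases "f i = Suc i")
  case True
  then have "f (Suc i) = i" using ncm_invol[OF f] by metis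
  then show ?thesis using True f surgery_cup by metis
next
  case False
  define a b g where "a = f i" and "b = f (Suc i)" and "g = surgery i f"
  have fa: "f a = i" "f b = Suc i" "f i = a" "f (Suc i) = b"
    using ncm_invol[OF f] by (auto simp: a_def b_def)
  have ne: "a \<noteq> i" "a \<noteq> Suc i" "b \<noteq> i" "b \<noteq> Suc i" "a \<noteq> b"
    using False ncm_neq[OF f, of i] ncm_neq[OF f, of "Suc i"] i fa by auto
  have g: "g i = Suc i" "g (Suc i) = i" "g a = b" "g b = a"
    using ne by (auto simp: g_def surgery_def fa)
  have go: "g p = f p" "f p \<noteq> i" "f p \<noteq> Suc i" "f p \<noteq> a" "f p \<noteq> b"
     if "p \<noteq> i" "p \<noteq> Suc i" "p \<noteq> a" "p \<noteq> b" for p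
    using that fa ncm_invol[OF f, of p] by (auto simp: g_def surgery_def)
  note ff = ncm_invol[OF f]
  note nest = ncm_nested[OF f]
  have inv: "g (g p) = p" for p
    using g go ff by (cases "p \<in> {i, Suc i, a, b}") auto
  have lt: "a < N" "b < N" using ncm_less[OF f] i by (auto simp: a_def b_def)
  have neq: "g p \<noteq> p \<longleftrightarrow> p < N" for p
  proof (cases "p \<in> {i, Suc i, a, b}")
    case True then show ?thesis using g ne i lt by auto
  next
    case False then show ?thesis using go ncm_neq[OF f, of p] by auto
  qed
  have ab: "a < i \<and> Suc i < b" if "a < b"
    using that nest[of i "Suc i"] nest[of a b] nest[of "Suc i" a] fa ne
    by (auto simp: neq_iff)
  have ba: "Suc i < b \<and> b < a \<or> b < a \<and> a < i" if "b < a"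
    using that nest[of i "Suc i"] nest[of b i] nest[of b a] fa ne
    by (auto simp: neq_iff)
  have nested: "p < g q \<and> g q < g p" if pq: "p < q" "q < g p" for p q
  proof -
    consider "p = i \<or> p = Suc i" | "p = a" | "p = b" | "p \<notin> {i, Suc i, a, b}" by blast
    then show ?thesis
    proof cases
      case 1 then show ?thesis using pq g by auto
    next
      case 2
      then have "a < b" using pq g by auto
      note o = ab[OF this]
      show ?thesis
      proof (cases "q \<in> {i, Suc i}")
        case True then show ?thesis using g 2 o by auto
      next
        case False
        then have "a < q \<and> q < i \<or> Suc i < q \<and> q < b" using 2 pq g by auto
        then show ?thesis using nest[of a q] nest[of "Suc i" q] fa 2 g o go[of q] pq by auto
      qed
    next
      case 3
      then have "b < a" using pq g by auto
      from ba[OF this] show ?thesis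
      proof
        assume o: "Suc i < b \<and> b < a"
        have "g q = f q" using o 3 pq g go[of q] by auto
        moreover have "i < f q \<and> f q < a" using nest[of i q] fa o 3 pq g by auto
        moreover have "\<not> f q < b"
          using nest[of "Suc i" "f q"] ff[of q] fa o 3 pq g calculation go[of q] by auto
        moreover have "f q \<noteq> b" using o 3 pq g go[of q] by auto
        ultimately show ?thesis using 3 g by auto
      next
        assume o: "b < a \<and> a < i"
        have "g q = f q" using o 3 pq g go[of q] by auto
        moreover have "b < f q \<and> f q < Suc i" using nest[of b q] fa o 3 pq g by auto
        moreover have "\<not> a < f q"
          using nest[of a "f q"] ff[of q] fa o 3 pq g calculation go[of q] by auto
        moreover have "f q \<noteq> a" using o 3 pq g go[of q] by auto
        ultimately show ?thesis using 3 g by auto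
      qed
    next
      case 4
      then have gp: "g p = f p" "f p \<noteq> i" "f p \<noteq> Suc i" "f p \<noteq> a" "f p \<noteq> b" using go[of p] by auto
      have i1: "p < i \<and> i < f p \<longleftrightarrow> p < Suc i \<and> Suc i < f p" using 4 gp by auto
      have ia: "p < i \<and> i < f p \<longleftrightarrow> p < a \<and> a < f p" using nest[of p i] nest[of p a] fa by auto
      have ib: "p < Suc i \<and> Suc i < f p \<longleftrightarrow> p < b \<and> b < f p"
        using nest[of p "Suc i"] nest[of p b] fa by auto
      show ?thesis
      proof (cases "q \<in> {i, Suc i, a, b}")
        case True then show ?thesis using i1 ia ib g gp pq by auto
      next
        case False then show ?thesis using nest[of p q] go[of q] gp pq by auto
      qed
    qed
  qed
  show ?thesis using inv neq nested by (simp add: nc_matchings_def g_def)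
qed

section \<open>Diagrams as matchings of boundary positions\<close>

text \<open>
  The inverse of \<open>bpos n m\<close>.
\<close>

definition site :: "nat \<Rightarrow> nat \<Rightarrow> nat \<Rightarrow> site" where
  "site n m p = (if p < n then Src p else Tgt (m - 1 - (p - n)))"

lemma bpos_site: "p < n + m \<Longrightarrow> bpos n m (site n m p) = p"
  by (auto simp: site_def)

lemma site_bpos: "a \<in> sites n m \<Longrightarrow> site n m (bpos n m a) = a"
  by (auto simp: site_def sites_def)

lemma bpos_less: "a \<in> sites n m \<Longrightarrow> bpos n m a < n + m"
  by (auto simp: sites_def)

lemma site_in: "p < n + m \<Longrightarrow> site n m p \<in> sites n m"
  by (auto simp: site_def sites_def)

lemma site_eq_iff: "p < n + m \<Longrightarrow> q < n + m \<Longrightarrow> site n m p = site n m q \<longleftrightarrow> p = q"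
  by (metis bpos_site)

definition diagram_of :: "nat \<Rightarrow> nat \<Rightarrow> (nat \<Rightarrow> nat) \<Rightarrow> diagram" where
  "diagram_of n m f = (\<lambda>p. {site n m p, site n m (f p)}) ` {..<n + m}"

lemma diagram_of_mem:
  assumes f: "f \<in> nc_matchings (n + m)" and "a \<in> sites n m"
  shows "{a, b} \<in> diagram_of n m f \<longleftrightarrow> b = site n m (f (bpos n m a))"
proof
  assume "{a, b} \<in> diagram_of n m f"
  then obtain p where p: "p < n + m" "{a, b} = {site n m p, site n m (f p)}"
    by (auto simp: diagram_of_def)
  have "f p < n + m" using p ncm_less[OF f] by blast
  then show "b = site n m (f (bpos n m a))"
    using p ncm_invol[OF f, of p] by (auto simp: doubleton_eq_iff bpos_site)
next
  assume "b = site n m (f (bpos n m a))"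
  then show "{a, b} \<in> diagram_of n m f"
    using assms(2) by (auto simp: diagram_of_def intro!: image_eqI[of _ _ "bpos n m a"] simp: site_bpos bpos_less)
qed

lemma diagram_of_inj: "inj_on (diagram_of n m) (nc_matchings (n + m))"
proof (rule inj_onI, rule ext)
  fix f g p assume fg: "f \<in> nc_matchings (n + m)" "g \<in> nc_matchings (n + m)" "diagram_of n m f = diagram_of n m g"
  show "f p = g p"
  proof (cases "p < n + m")
    case True
    then have "{site n m p, site n m (f p)} \<in> diagram_of n m g" using fg by (auto simp: diagram_of_def)
    then have "site n m (f p) = site n m (g p)"
      using diagram_of_mem[OF fg(2) site_in[OF True]] bpos_site[OF True] by simp
    then show ?thesis using True fg ncm_less[OF fg(1)] ncm_less[OF fg(2)] site_eq_iff by blast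
  next
    case False then show ?thesis using ncm_neq[OF fg(1)] ncm_neq[OF fg(2)] by metis
  qed
qed

lemma diagram_of_sites: "f \<in> nc_matchings (n + m) \<Longrightarrow> {a, b} \<in> diagram_of n m f \<Longrightarrow> a \<in> sites n m"
  by (auto simp: diagram_of_def doubleton_eq_iff ncm_less intro!: site_in)

lemma diagram_of_in_diagrams:
  assumes f: "f \<in> nc_matchings (n + m)"
  shows "diagram_of n m f \<in> diagrams n m"
proof -
  have less: "f p < n + m \<longleftrightarrow> p < n + m" for p using ncm_less[OF f] .
  have ne: "f p \<noteq> p" if "p < n + m" for p using ncm_neq[OF f] that by blast
  have "card P = 2" if P: "P \<in> diagram_of n m f" for P
  proof -
    obtain p where p: "p < n + m" "P = {site n m p, site n m (f p)}"
      using P by (auto simp: diagram_of_def)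
    then have "site n m p \<noteq> site n m (f p)" using ne less site_eq_iff by metis
    then show ?thesis using p by simp
  qed
  moreover have "partition_on (sites n m) (diagram_of n m f)"
  proof (rule partition_onI)
    show "\<Union> (diagram_of n m f) = sites n m"
    proof
      show "\<Union> (diagram_of n m f) \<subseteq> sites n m"
        unfolding diagram_of_def using site_in less by blast
      show "sites n m \<subseteq> \<Union> (diagram_of n m f)"
      proof
        fix a assume a: "a \<in> sites n m"
        then have "{a, site n m (f (bpos n m a))} \<in> diagram_of n m f" by (simp add: diagram_of_mem[OF f])
        then show "a \<in> \<Union> (diagram_of n m f)" by blast
      qed
    qed
    show "{} \<notin> diagram_of n m f" by (auto simp: diagram_of_def)
    fix p q assume "p \<in> diagram_of n m f" "q \<in> diagram_of n m f" "p \<noteq> q"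
    then obtain x y where xy: "x < n + m" "p = {site n m x, site n m (f x)}"
        "y < n + m" "q = {site n m y, site n m (f y)}" "p \<noteq> q"
      unfolding diagram_of_def by blast
    then have "x \<noteq> y" "f x \<noteq> y" "x \<noteq> f y" "f x \<noteq> f y"
      using ncm_invol[OF f] by (metis insert_commute)+
    then show "disjnt p q"
      using xy less by (simp add: disjnt_def site_eq_iff)
  qed
  moreover have nc: "\<not> (\<exists>a b c d. {a, b} \<in> diagram_of n m f \<and> {c, d} \<in> diagram_of n m f \<and>
          bpos n m a < bpos n m c \<and> bpos n m c < bpos n m b \<and> bpos n m b < bpos n m d)"
  proof clarify
    fix a b c d assume *: "{a, b} \<in> diagram_of n m f" "{c, d} \<in> diagram_of n m f"
          "bpos n m a < bpos n m c" "bpos n m c < bpos n m b" "bpos n m b < bpos n m d"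
    have a: "a \<in> sites n m" "c \<in> sites n m" using * diagram_of_sites[OF f] by blast+
    have "bpos n m b = f (bpos n m a)" "bpos n m d = f (bpos n m c)"
      using a * by (auto simp: diagram_of_mem[OF f] bpos_site less bpos_less)
    then show False using ncm_nested[OF f, of "bpos n m a" "bpos n m c"] * by auto
  qed
  ultimately show ?thesis unfolding diagrams_def by (intro CollectI conjI ballI)
qed

text \<open>
  Each block of the partition has two elements, so it defines a partner for each boundary position.
\<close>

lemma diagram_is_diagram_of:
  assumes D: "D \<in> diagrams n m"
  shows "\<exists>f\<in>nc_matchings (n + m). D = diagram_of n m f"
proof -
  have part: "partition_on (sites n m) D" and card2: "\<And>p. p \<in> D \<Longrightarrow> card p = 2"
    and nc: "\<And>a b c d. {a, b} \<in> D \<Longrightarrow> {c, d} \<in> D \<Longrightarrow>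
          bpos n m a < bpos n m c \<Longrightarrow> bpos n m c < bpos n m b \<Longrightarrow> \<not> bpos n m b < bpos n m d"
    using D unfolding diagrams_def by blast+
  have un: "\<Union> D = sites n m" using part by (simp add: partition_on_def)
  have dj: "P = Q" if "P \<in> D" "Q \<in> D" "x \<in> P" "x \<in> Q" for P Q x
    using partition_onD2[OF part] that disjointD by blast
  have ex: "\<exists>q. q < n + m \<and> q \<noteq> p \<and> {site n m p, site n m q} \<in> D" if p: "p < n + m" for p
  proof -
    obtain P where P: "P \<in> D" "site n m p \<in> P" using un site_in[OF p] by blast
    obtain b where b: "P = {site n m p, b}" "b \<noteq> site n m p"
      using card2[OF P(1)] P(2) by (auto simp: card_2_iff)
    then have "b \<in> sites n m" using P un by blast
    then show ?thesis
      using b P site_bpos bpos_less by (intro exI[of _ "bpos n m b"]) auto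
  qed
  have uniq: "q = q'" if "p < n + m" "q < n + m" "q' < n + m"
      "{site n m p, site n m q} \<in> D" "{site n m p, site n m q'} \<in> D" "q \<noteq> p" "q' \<noteq> p" for p q q'
  proof -
    have "{site n m p, site n m q} = {site n m p, site n m q'}"
      using dj[OF that(4,5), of "site n m p"] by simp
    then show ?thesis using that by (auto simp: doubleton_eq_iff site_eq_iff)
  qed
  define f where "f p = (if p < n + m then SOME q. q < n + m \<and> q \<noteq> p \<and> {site n m p, site n m q} \<in> D else p)" for p
  have f: "f p < n + m \<and> f p \<noteq> p \<and> {site n m p, site n m (f p)} \<in> D" if "p < n + m" for p
    using someI_ex[OF ex[OF that]] that by (simp add: f_def)
  have inv: "f (f p) = p" for p
  proof (cases "p < n + m")
    case True
    then show ?thesis using f[of p] f[of "f p"] uniq[of "f p" "f (f p)" p]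
      by (auto simp: insert_commute)
  qed (auto simp: f_def)
  have neq: "f p \<noteq> p \<longleftrightarrow> p < n + m" for p using f[of p] by (auto simp: f_def)
  have nest: "p < f q \<and> f q < f p" if "p < q" "q < f p" for p q
  proof -
    have p: "p < n + m" using that f_def by (metis less_asym not_less_iff_gr_or_eq)
    have q: "q < n + m" using f[OF p] that by simp
    have *: "{site n m p, site n m (f p)} \<in> D" "{site n m q, site n m (f q)} \<in> D"
      "{site n m (f q), site n m q} \<in> D"
      using f p q by (auto simp: insert_commute)
    have l: "f p < n + m" "f q < n + m" using f p q by auto
    have "f q \<noteq> p" "f q \<noteq> f p" using inv that by (metis less_irrefl less_asym)+
    moreover have "\<not> f p < f q" using nc[OF *(1,2)] p q l that by (simp add: bpos_site)
    moreover have "\<not> f q < p" using nc[OF *(3,1)] p q l that by (auto simp: bpos_site)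
    ultimately show ?thesis by auto
  qed
  have "f \<in> nc_matchings (n + m)" using inv neq nest by (simp add: nc_matchings_def)
  moreover have "D = diagram_of n m f"
  proof
    show "diagram_of n m f \<subseteq> D" using f by (auto simp: diagram_of_def)
    show "D \<subseteq> diagram_of n m f"
    proof
      fix P assume P: "P \<in> D"
      then obtain a b where ab: "P = {a, b}" using card2 by (meson card_2_iff)
      then have a: "a \<in> sites n m" using un P by blast
      then have "{a, site n m (f (bpos n m a))} \<in> D" using f[of "bpos n m a"] bpos_less[OF a]
        by (simp add: site_bpos)
      then have "P = {a, site n m (f (bpos n m a))}" using dj[OF P, of _ a] ab by simp
      then show "P \<in> diagram_of n m f" using a by (simp add: diagram_of_mem[OF calculation])
    qed
  qed
  ultimately show ?thesis by blast
qed

text \<open>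
  The positions \<open>n, \<dots>, n + m - 1\<close> are the targets.
\<close>

definition monic_matchings :: "nat \<Rightarrow> nat \<Rightarrow> (nat \<Rightarrow> nat) set" where
  "monic_matchings n m = {f \<in> nc_matchings (n + m). \<forall>p. n \<le> p \<and> p < n + m \<longrightarrow> f p < n}"

lemma diagram_of_monic_iff:
  assumes f: "f \<in> nc_matchings (n + m)"
  shows "diagram_of n m f \<in> monic_diagrams n m \<longleftrightarrow> f \<in> monic_matchings n m"
proof -
  have less: "f p < n + m \<longleftrightarrow> p < n + m" for p using ncm_less[OF f] .
  have *: "(\<exists>i<n. {Src i, Tgt j} \<in> diagram_of n m f) \<longleftrightarrow> f (n + (m - 1 - j)) < n" if j: "j < m" for j
  proof -
    have "{Src i, Tgt j} \<in> diagram_of n m f \<longleftrightarrow> Src i = site n m (f (n + (m - 1 - j)))" for i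
      using diagram_of_mem[OF f, of "Tgt j" "Src i"] j by (simp add: insert_commute[of "Src i"] sites_def)
    then show ?thesis by (auto simp: site_def)
  qed
  have "(\<forall>j<m. f (n + (m - 1 - j)) < n) \<longleftrightarrow> (\<forall>p. n \<le> p \<and> p < n + m \<longrightarrow> f p < n)"
  proof safe
    fix p assume h: "\<forall>j<m. f (n + (m - 1 - j)) < n" "n \<le> p" "p < n + m"
    have "m - 1 - (p - n) < m" "n + (m - 1 - (m - 1 - (p - n))) = p" using h(2,3) by linarith+
    then show "f p < n" using h(1) by metis
  qed auto
  then show ?thesis using * diagram_of_in_diagrams[OF f] f unfolding monic_diagrams_def monic_matchings_def by simp
qed

lemma monic_diagrams_eq: "monic_diagrams n m = diagram_of n m ` monic_matchings n m"
proof (rule set_eqI)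
  fix D
  have "D \<in> monic_diagrams n m \<longleftrightarrow> D \<in> diagrams n m \<and> D \<in> monic_diagrams n m"
    by (auto simp: monic_diagrams_def)
  also have "\<dots> \<longleftrightarrow> (\<exists>f\<in>nc_matchings (n + m). D = diagram_of n m f \<and> D \<in> monic_diagrams n m)"
    using diagram_is_diagram_of diagram_of_in_diagrams by metis
  also have "\<dots> \<longleftrightarrow> (\<exists>f\<in>nc_matchings (n + m). D = diagram_of n m f \<and> f \<in> monic_matchings n m)"
    using diagram_of_monic_iff by metis
  also have "\<dots> \<longleftrightarrow> D \<in> diagram_of n m ` monic_matchings n m"
    unfolding monic_matchings_def by blast
  finally show "D \<in> monic_diagrams n m \<longleftrightarrow> D \<in> diagram_of n m ` monic_matchings n m" .
qed

section \<open>Left multiplication by a generator is surgery\<close>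

text \<open>
  The matching of the identity diagram: source \<open>k\<close> and target \<open>k\<close> sit at
  positions \<open>k\<close> and \<open>2n - 1 - k\<close>.
\<close>

definition id_matching :: "nat \<Rightarrow> nat \<Rightarrow> nat" where
  "id_matching n p = (if p < n + n then n + n - Suc p else p)"

lemma id_matching_ncm: "id_matching n \<in> nc_matchings (n + n)"
proof -
  have "id_matching n (id_matching n p) = p" for p by (simp add: id_matching_def)
  moreover have "id_matching n p \<noteq> p \<longleftrightarrow> p < n + n" for p
    by (simp add: id_matching_def) presburger
  moreover have "p < id_matching n q \<and> id_matching n q < id_matching n p"
    if "p < q" "q < id_matching n p" for p q
  proof -
    have "p < n + n" using that by (simp add: id_matching_def split: if_splits)
    then show ?thesis using that by (simp add: id_matching_def) linarith
  qed
  ultimately show ?thesis by (simp add: nc_matchings_def)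
qed

text \<open>
  The usual generator \<open>U\<^sub>i\<close>. Obtaining it by surgery from the identity gives for free
  that it is a diagram.
\<close>

definition tl_gen :: "nat \<Rightarrow> nat \<Rightarrow> diagram" where
  "tl_gen n i = diagram_of n n (surgery i (id_matching n))"

lemma tl_gen_in_diagrams: "Suc i < n \<Longrightarrow> tl_gen n i \<in> diagrams n n"
  by (simp add: tl_gen_def diagram_of_in_diagrams surgery_nc_matching id_matching_ncm)

lemma tl_gen_eq:
  assumes i: "Suc i < n"
  shows "tl_gen n i = insert {Src i, Src (Suc i)} (insert {Tgt i, Tgt (Suc i)}
     ((\<lambda>k. {Src k, Tgt k}) ` ({..<n} - {i, Suc i})))" (is "_ = insert _ (insert _ ?K)")
proof -
  let ?g = "surgery i (id_matching n)"
  let ?B = "\<lambda>p. {site n n p, site n n (?g p)}"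
  note id = id_matching_ncm[of n]
  have val: "id_matching n i = n + n - Suc i" "id_matching n (Suc i) = n + n - Suc (Suc i)"
    using i by (auto simp: id_matching_def)
  have g: "?g (n + n - Suc i) = n + n - Suc (Suc i)" "?g (n + n - Suc (Suc i)) = n + n - Suc i"
    using surgery_partner[OF id, of i] i unfolding val by auto
  have gk: "?g k = n + n - Suc k" "?g (n + n - Suc k) = k" if "k < n" "k \<noteq> i" "k \<noteq> Suc i" for k
    using surgery_other[OF id, of k i] surgery_other[OF id, of "n + n - Suc k" i] that i
    by (auto simp: id_matching_def)
  have st: "site n n k = Src k" "site n n (n + n - Suc k) = Tgt k" if "k < n" for k
    using that by (auto simp: site_def)
  have B: "?B i = {Src i, Src (Suc i)}" "?B (Suc i) = {Src i, Src (Suc i)}"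
     "?B (n + n - Suc i) = {Tgt i, Tgt (Suc i)}" "?B (n + n - Suc (Suc i)) = {Tgt i, Tgt (Suc i)}"
    using i unfolding g surgery_simps by (auto simp: st)
  have Bk: "?B k = {Src k, Tgt k}" "?B (n + n - Suc k) = {Src k, Tgt k}"
    if "k < n" "k \<noteq> i" "k \<noteq> Suc i" for k
    using that unfolding gk[OF that] by (auto simp: st)
  have split: "{..<n + n} = {..<n} \<union> (\<lambda>k. n + n - Suc k) ` {..<n}"
  proof (rule set_eqI)
    fix p
    have "p = n + n - Suc (n + n - Suc p)" if "p < n + n" using that by simp
    moreover have "n + n - Suc p < n" if "\<not> p < n" using that i by simp
    ultimately show "p \<in> {..<n + n} \<longleftrightarrow> p \<in> {..<n} \<union> (\<lambda>k. n + n - Suc k) ` {..<n}"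
      by (cases "p < n") (auto simp: image_iff Bex_def)
  qed
  have "{..<n} = insert i (insert (Suc i) ({..<n} - {i, Suc i}))" using i by auto
  then have "tl_gen n i = ?B ` insert i (insert (Suc i) ({..<n} - {i, Suc i})) \<union>
     ?B ` (\<lambda>k. n + n - Suc k) ` insert i (insert (Suc i) ({..<n} - {i, Suc i}))"
    unfolding tl_gen_def diagram_of_def split image_Un by simp
  moreover have "?B ` ({..<n} - {i, Suc i}) = ?K"
    using Bk by (intro image_cong) auto
  moreover have "?B ` (\<lambda>k. n + n - Suc k) ` ({..<n} - {i, Suc i}) = ?K"
    unfolding image_image using Bk by (intro image_cong) auto
  ultimately have "tl_gen n i =
      insert {Src i, Src (Suc i)} (insert {Src i, Src (Suc i)} ?K) \<union>
      insert {Tgt i, Tgt (Suc i)} (insert {Tgt i, Tgt (Suc i)} ?K)"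
    by (simp only: image_insert B)
  then show ?thesis by (simp only: insert_absorb2 Un_insert_left Un_insert_right Un_absorb insert_commute)
qed

text \<open>
  To find the components of a graph it suffices to guess a labelling that is constant along edges and
  separates components.
\<close>

lemma quotient_rtrancl_eq:
  assumes sym: "sym R"
    and inv: "\<And>x y. (x, y) \<in> R \<Longrightarrow> x \<in> V \<and> y \<in> V \<and> h x = h y"
    and conn: "\<And>x y. x \<in> V \<Longrightarrow> y \<in> V \<Longrightarrow> h x = h y \<Longrightarrow> (x, y) \<in> R\<^sup>*"
  shows "V // R\<^sup>* = (\<lambda>l. {y \<in> V. h y = l}) ` (h ` V)"
proof -
  have 1: "y \<in> V \<and> h x = h y" if "(x, y) \<in> R\<^sup>*" "x \<in> V" for x y
    using that by induction (use inv in metis)+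
  have "R\<^sup>* `` {x} = {y \<in> V. h y = h x}" if "x \<in> V" for x
  proof (rule set_eqI)
    fix y show "y \<in> R\<^sup>* `` {x} \<longleftrightarrow> y \<in> {y \<in> V. h y = h x}"
      using 1[of x y] conn[of x y] that by auto
  qed
  then show ?thesis by (auto simp: quotient_def image_iff)
qed

text \<open>
  In \<open>U\<^sub>i D\<close> the left node \<open>k\<close> takes over the boundary position of the
  middle node \<open>k\<close>, which is the source \<open>k\<close> of \<open>D\<close>.
\<close>

fun node_pos :: "nat \<Rightarrow> nat \<Rightarrow> node \<Rightarrow> nat" where
  "node_pos n m (LeftNode k) = k"
| "node_pos n m (MidNode k) = k"
| "node_pos n m (RightNode j) = n + (m - 1 - j)"

lemma diagram_ofI: "p < n + m \<Longrightarrow> {site n m p, site n m (f p)} \<in> diagram_of n m f"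
  by (simp add: diagram_of_def)

text \<open>
  Each node of the glued graph is labelled by the line of the composite to which it belongs, or by the
  empty set if it lies on a loop. The middle nodes \<open>i\<close> and \<open>Suc i\<close> lie on the
  line joining their former partners, except when they form a loop. All other nodes lie on the line
  through their boundary position. With this labelling the component with label \<open>l\<close> meets
  the outer nodes precisely in \<open>l\<close>.
\<close>

lemma compose_tl_gen:
  assumes f: "f \<in> nc_matchings (n + m)" and i: "Suc i < n"
  shows "compose_diagram (tl_gen n i) (diagram_of n m f) = diagram_of n m (surgery i f)"
    and "f i \<noteq> Suc i \<Longrightarrow> loops (tl_gen n i) (diagram_of n m f) = 0"
proof -
  let ?N = "n + m"
  define g where "g = surgery i f"
  have g: "g \<in> nc_matchings ?N" using surgery_nc_matching[OF f] i by (simp add: g_def)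
  have gi: "g i = Suc i" "g (Suc i) = i" by (auto simp: g_def)
  define rn where "rn p = right_node (site n m p)" for p
  define G where "G = glued_edges (tl_gen n i) (diagram_of n m f)"
  define R where "R = {(u, v). {u, v} \<in> G}"
  define V where "V = \<Union> G"
  \<comment> \<open>the cup of the generator in the middle column closes a loop or connects the two partners\<close>
  define lab where "lab x = (if x = MidNode i \<or> x = MidNode (Suc i)
      then if f i = Suc i then {} else {site n m (f i), site n m (f (Suc i))}
      else {site n m (node_pos n m x), site n m (g (node_pos n m x))})" for x
  have rn: "rn p = MidNode p" if "p < n" for p using that by (simp add: rn_def site_def)
  have rn_mid: "rn p = MidNode k \<longleftrightarrow> p = k" if "k < n" for p k
    using that by (auto simp: rn_def site_def)
  have rn_pos: "node_pos n m (rn p) = p" if "p < ?N" for p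
    using that by (auto simp: rn_def site_def)
  have G: "G = insert {LeftNode i, LeftNode (Suc i)} (insert {MidNode i, MidNode (Suc i)}
     ((\<lambda>k. {LeftNode k, MidNode k}) ` ({..<n} - {i, Suc i}) \<union> (\<lambda>p. {rn p, rn (f p)}) ` {..<?N}))"
    unfolding G_def glued_edges_def tl_gen_eq[OF i] diagram_of_def rn_def image_insert image_image
      image_empty left_node.simps right_node.simps by blast
  have fless: "f p < ?N \<longleftrightarrow> p < ?N" for p using ncm_less[OF f] .
  have gless: "g p < ?N \<longleftrightarrow> p < ?N" for p using ncm_less[OF g] .
  have ff: "f (f p) = p" for p using ncm_invol[OF f] .
  have V: "V = LeftNode ` {..<n} \<union> rn ` {..<?N}"
  proof (rule equalityI)
    show "V \<subseteq> LeftNode ` {..<n} \<union> rn ` {..<?N}"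
    proof
      fix x assume "x \<in> V"
      then consider k where "k < n" "x = LeftNode k" | k where "k < n" "x = MidNode k"
        | p where "p < ?N" "x = rn p" | p where "p < ?N" "x = rn (f p)"
        using i unfolding V_def G by fastforce
      then show "x \<in> LeftNode ` {..<n} \<union> rn ` {..<?N}"
      proof cases
        case 2 then show ?thesis using rn[of k] by (auto intro!: image_eqI[of _ _ k])
      next
        case 4 then show ?thesis using fless by blast
      qed auto
    qed
    have "LeftNode k \<in> V" if "k < n" for k
      using that unfolding V_def G by (cases "k = i \<or> k = Suc i") auto
    then show "LeftNode ` {..<n} \<union> rn ` {..<?N} \<subseteq> V"
      unfolding V_def G by blast
  qed
  have RI: "(u, v) \<in> R" if "{u, v} \<in> G" for u v using that by (simp add: R_def)
  have e1: "(LeftNode i, LeftNode (Suc i)) \<in> R" by (rule RI) (simp add: G)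
  have e2: "(MidNode i, MidNode (Suc i)) \<in> R" by (rule RI) (simp add: G)
  have e3: "(LeftNode k, rn k) \<in> R" if "k < n" "k \<noteq> i" "k \<noteq> Suc i" for k
    using that by (intro RI) (simp add: G rn)
  have e4: "(rn p, rn (f p)) \<in> R" if "p < ?N" for p
    using that by (intro RI) (simp add: G)
  have sym: "sym R" unfolding R_def by (auto simp: sym_def insert_commute)
  have symT: "(v, u) \<in> R\<^sup>*" if "(u, v) \<in> R\<^sup>*" for u v
    using sym_rtrancl[OF sym] that by (meson symD)
  have a: "f i \<noteq> i" "f (Suc i) \<noteq> Suc i" using ncm_neq[OF f] i by auto
  have a': "f (Suc i) \<noteq> i" "g (f i) = f (Suc i)" "g (f (Suc i)) = f i" if "f i \<noteq> Suc i"
    using that surgery_partner[OF f that] ff[of "Suc i"] i by (auto simp: g_def)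
  have go: "g p = f p" if "p \<noteq> i" "p \<noteq> Suc i" "f p \<noteq> i" "f p \<noteq> Suc i" for p
    using surgery_other[OF f that] by (simp add: g_def)
  have labrn: "lab (rn p) = {site n m p, site n m (g p)}" if "p < ?N" "p \<noteq> i" "p \<noteq> Suc i" for p
    using that i by (simp add: lab_def rn_mid rn_pos)
  have labrn_i: "lab (rn i) = lab (rn (Suc i))" using i by (simp add: lab_def rn)
  have lab_f: "lab (rn p) = lab (rn (f p))" if p: "p < ?N" for p
  proof -
    have *: "lab (rn i) = lab (rn (f i))"
    proof (cases "f i = Suc i")
      case True then show ?thesis using labrn_i by simp
    next
      case False
      then have "lab (rn (f i)) = {site n m (f i), site n m (f (Suc i))}"
        using labrn[of "f i"] a a' i by (simp add: fless)
      then show ?thesis using False i by (simp add: lab_def rn)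
    qed
    have **: "lab (rn (Suc i)) = lab (rn (f (Suc i)))"
    proof (cases "f i = Suc i")
      case True then show ?thesis using labrn_i ff[of i] by simp
    next
      case False
      then have "lab (rn (f (Suc i))) = {site n m (f i), site n m (f (Suc i))}"
        using labrn[of "f (Suc i)"] a a' i by (simp add: fless insert_commute)
      then show ?thesis using False i by (simp add: lab_def rn)
    qed
    consider "p = i" | "p = Suc i" | "f p = i" | "f p = Suc i"
      | "p \<noteq> i" "p \<noteq> Suc i" "f p \<noteq> i" "f p \<noteq> Suc i" by blast
    then show ?thesis
    proof cases
      case 3 then show ?thesis using * ff[of p] by simp
    next
      case 4 then show ?thesis using ** ff[of p] by simp
    next
      case 5
      then have "g p = f p" "g (f p) = p" using go[of p] go[of "f p"] ff[of p] by auto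
      then show ?thesis using labrn[of p] labrn[of "f p"] 5 p fless by (simp add: insert_commute)
    qed (use * ** in auto)
  qed
  have inv: "x \<in> V \<and> y \<in> V \<and> lab x = lab y" if xy: "(x, y) \<in> R" for x y
  proof -
    have e: "{x, y} \<in> G" using xy by (simp add: R_def)
    have key: "lab x = lab y" if "{x, y} = {u, v}" "lab u = lab v" for u v
      using that by (auto simp: doubleton_eq_iff)
    consider "{x, y} = {LeftNode i, LeftNode (Suc i)}" | "{x, y} = {MidNode i, MidNode (Suc i)}"
      | k where "k < n" "k \<noteq> i" "k \<noteq> Suc i" "{x, y} = {LeftNode k, MidNode k}"
      | p where "p < ?N" "{x, y} = {rn p, rn (f p)}" using e unfolding G by blast
    then have "lab x = lab y"
    proof cases
      case 1 then show ?thesis by (rule key) (simp add: lab_def gi insert_commute)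
    next
      case 2 then show ?thesis by (rule key) (simp add: lab_def)
    next
      case 3
      show ?thesis by (rule key[OF 3(4)]) (use 3 in \<open>simp add: lab_def\<close>)
    next
      case 4
      show ?thesis by (rule key[OF 4(2) lab_f[OF 4(1)]])
    qed
    then show ?thesis using e unfolding V_def by blast
  qed
  have g_conn: "(rn q, rn (g q)) \<in> R\<^sup>*" if q: "q < ?N" "q \<noteq> i" "q \<noteq> Suc i" for q
  proof -
    have m: "(rn i, rn (Suc i)) \<in> R\<^sup>*" using e2 i rn by (simp add: r_into_rtrancl)
    have 1: "(rn (f i), rn i) \<in> R\<^sup>*" "(rn (f (Suc i)), rn (Suc i)) \<in> R\<^sup>*"
      using e4[of i] e4[of "Suc i"] i symT by (simp_all add: r_into_rtrancl)
    have path: "(rn (f i), rn (f (Suc i))) \<in> R\<^sup>*"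
      using 1 m symT rtrancl_trans by metis
    consider "f q = i" | "f q = Suc i" | "f q \<noteq> i" "f q \<noteq> Suc i" by blast
    then show ?thesis
    proof cases
      case 1
      then have "q = f i" using ff by metis
      then show ?thesis using path a' q by simp
    next
      case 2
      then have "q = f (Suc i)" using ff by metis
      moreover have "f i \<noteq> Suc i" using ff[of i] q 2 calculation by auto
      ultimately show ?thesis using symT[OF path] a' by simp
    next
      case 3
      then show ?thesis using go[of q] q e4[of q] by (simp add: r_into_rtrancl)
    qed
  qed
  \<comment> \<open>every node reaches a node of the right-hand diagram, apart from the two exceptional components\<close>
  have rep: "(\<exists>q<?N. q \<noteq> i \<and> q \<noteq> Suc i \<and> (x, rn q) \<in> R\<^sup>* \<and> lab x = {site n m q, site n m (g q)})
     \<or> x \<in> {LeftNode i, LeftNode (Suc i)} \<and> lab x = {site n m i, site n m (Suc i)}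
     \<or> f i = Suc i \<and> x \<in> {MidNode i, MidNode (Suc i)} \<and> lab x = {}" if x: "x \<in> V" for x
  proof -
    consider "x = LeftNode i \<or> x = LeftNode (Suc i)"
      | k where "k < n" "k \<noteq> i" "k \<noteq> Suc i" "x = LeftNode k"
      | p where "p < ?N" "p \<noteq> i" "p \<noteq> Suc i" "x = rn p"
      | p where "p = i \<or> p = Suc i" "x = rn p"
      using x unfolding V by blast
    then show ?thesis
    proof cases
      case 1 then show ?thesis by (auto simp: lab_def gi)
    next
      case 2
      then have "(x, rn k) \<in> R\<^sup>*" "lab x = {site n m k, site n m (g k)}"
        using e3 by (auto simp: lab_def)
      then show ?thesis using 2 by (intro disjI1 exI[of _ k]) simp
    next
      case 3
      then show ?thesis using labrn by blast
    next
      case 4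
      show ?thesis
      proof (cases "f i = Suc i")
        case True
        then show ?thesis using 4 i by (auto simp: lab_def rn)
      next
        case False
        have "p < ?N" using 4 i by auto
        moreover have "f p \<noteq> i" "f p \<noteq> Suc i" using 4 a a' False by auto
        ultimately show ?thesis using 4(2) e4[of p] lab_f[of p] labrn[of "f p"] fless
          by (intro disjI1 exI[of _ "f p"]) (simp add: r_into_rtrancl)
      qed
    qed
  qed
  have conn: "(x, y) \<in> R\<^sup>*" if xy: "x \<in> V" "y \<in> V" "lab x = lab y" for x y
  proof -
    have ne: "{site n m q, b} \<noteq> {site n m i, site n m (Suc i)}" if "q < ?N" "q \<noteq> i" "q \<noteq> Suc i" for q b
      using that i site_eq_iff[of q n m i] site_eq_iff[of q n m "Suc i"] by (auto simp: doubleton_eq_iff)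
    show ?thesis using rep[OF xy(1)]
    proof (elim disjE exE conjE)
      fix q assume q: "q < ?N" "q \<noteq> i" "q \<noteq> Suc i" "(x, rn q) \<in> R\<^sup>*" "lab x = {site n m q, site n m (g q)}"
      then obtain q' where q': "q' < ?N" "(y, rn q') \<in> R\<^sup>*" "lab y = {site n m q', site n m (g q')}"
        using rep[OF xy(2)] ne[of q] xy(3) by auto
      then have "site n m q' = site n m q \<or> site n m q' = site n m (g q)"
        using q(5) xy(3) by (auto simp: doubleton_eq_iff)
      then have "q' = q \<or> q' = g q" using q q' site_eq_iff gless by metis
      then have "(rn q, rn q') \<in> R\<^sup>*" using g_conn[of q] q by auto
      then show ?thesis using q(4) symT[OF q'(2)] by (meson rtrancl_trans)
    next
      assume x: "x \<in> {LeftNode i, LeftNode (Suc i)}" "lab x = {site n m i, site n m (Suc i)}"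
      then have "y \<in> {LeftNode i, LeftNode (Suc i)}"
        using rep[OF xy(2)] ne[of _ "site n m (g _)"] x(2) xy(3) by (metis insert_not_empty)
      then show ?thesis using x e1 symT[of "LeftNode i" "LeftNode (Suc i)"] by (auto simp: r_into_rtrancl)
    next
      assume x: "x \<in> {MidNode i, MidNode (Suc i)}" "lab x = {}"
      then have "y \<in> {MidNode i, MidNode (Suc i)}"
        using rep[OF xy(2)] xy(3) by auto
      then show ?thesis using x e2 symT[of "MidNode i" "MidNode (Suc i)"] by (auto simp: r_into_rtrancl)
    qed
  qed
  have comp: "glued_components (tl_gen n i) (diagram_of n m f) = (\<lambda>l. {y \<in> V. lab y = l}) ` (lab ` V)"
  proof -
    have "glued_components (tl_gen n i) (diagram_of n m f) = V // R\<^sup>*"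
      by (simp only: glued_components_def V_def R_def G_def)
    also have "\<dots> = (\<lambda>l. {y \<in> V. lab y = l}) ` (lab ` V)"
      by (rule quotient_rtrancl_eq[OF sym inv conn])
    finally show ?thesis .
  qed
  have outerV: "outer_node s \<in> V \<longleftrightarrow> s \<in> sites n m" for s
  proof (cases s)
    case (Src k)
    have "rn p \<noteq> LeftNode k" for p by (cases "site n m p") (auto simp: rn_def)
    then have "outer_node s \<in> V \<longleftrightarrow> k < n" unfolding V Src by force
    then show ?thesis by (auto simp: Src sites_def)
  next
    case (Tgt j)
    have "RightNode j \<in> rn ` {..<?N} \<longleftrightarrow> j < m"
    proof
      assume "j < m"
      then have "rn (n + (m - 1 - j)) = RightNode j" "n + (m - 1 - j) < ?N"
        by (auto simp: rn_def site_def)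
      then show "RightNode j \<in> rn ` {..<?N}" by (metis image_eqI lessThan_iff)
    qed (auto simp: rn_def site_def split: if_splits)
    then have "outer_node s \<in> V \<longleftrightarrow> j < m" unfolding V Tgt by auto
    then show ?thesis by (auto simp: Tgt sites_def)
  qed
  have lab_outer: "lab (outer_node s) = {s, site n m (g (bpos n m s))}" if "s \<in> sites n m" for s
  proof -
    have "node_pos n m (outer_node s) = bpos n m s" by (cases s) auto
    moreover have "outer_node s \<noteq> MidNode k" for k by (cases s) auto
    ultimately show ?thesis using site_bpos[OF that] by (simp add: lab_def)
  qed
  have labV: "lab x = {} \<and> f i = Suc i \<or> lab x \<in> diagram_of n m g" if "x \<in> V" for x
    using rep[OF that]
  proof (elim disjE exE conjE)
    fix q assume "q < ?N" "lab x = {site n m q, site n m (g q)}"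
    then show ?thesis using diagram_ofI by metis
  next
    assume "lab x = {site n m i, site n m (Suc i)}"
    then show ?thesis using diagram_ofI[of i n m g] gi i by simp
  qed auto
  have pre: "outer_node -` {y \<in> V. lab y = l} = l" if "l \<in> diagram_of n m g \<or> l = {}" for l
  proof -
    have "outer_node -` {y \<in> V. lab y = l} = {s \<in> sites n m. {s, site n m (g (bpos n m s))} = l}"
    proof (rule set_eqI)
      fix s
      show "s \<in> outer_node -` {y \<in> V. lab y = l} \<longleftrightarrow> s \<in> {s \<in> sites n m. {s, site n m (g (bpos n m s))} = l}"
        by (cases "s \<in> sites n m") (simp_all add: outerV lab_outer)
    qed
    also have "\<dots> = l" using that
    proof
      assume "l \<in> diagram_of n m g"
      then obtain p where p: "p < ?N" "l = {site n m p, site n m (g p)}" unfolding diagram_of_def by blast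
      have "{s, site n m (g (bpos n m s))} = l" if "s \<in> l" for s
        using that p ncm_invol[OF g] gless[of p] by (auto simp: bpos_site)
      moreover have "l \<subseteq> sites n m" using p site_in gless by auto
      ultimately show ?thesis by blast
    qed auto
    finally show ?thesis .
  qed
  have "compose_diagram (tl_gen n i) (diagram_of n m f) = (\<lambda>l. outer_node -` {y \<in> V. lab y = l}) ` (lab ` V) - {{}}"
    unfolding compose_diagram_def comp image_image ..
  also have "(\<lambda>l. outer_node -` {y \<in> V. lab y = l}) ` (lab ` V) = (\<lambda>l. l) ` (lab ` V)"
  proof (rule image_cong[OF refl])
    fix l assume "l \<in> lab ` V"
    then have "l \<in> diagram_of n m g \<or> l = {}" using labV by blast
    then show "outer_node -` {y \<in> V. lab y = l} = l" by (rule pre)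
  qed
  also have "(\<lambda>l. l) ` (lab ` V) - {{}} = diagram_of n m g"
  proof (rule equalityI)
    show "(\<lambda>l. l) ` (lab ` V) - {{}} \<subseteq> diagram_of n m g" using labV by auto
    show "diagram_of n m g \<subseteq> (\<lambda>l. l) ` (lab ` V) - {{}}"
    proof
      fix l assume "l \<in> diagram_of n m g"
      then obtain p where p: "p < ?N" "l = {site n m p, site n m (g p)}" unfolding diagram_of_def by blast
      then have "lab (outer_node (site n m p)) = l" "outer_node (site n m p) \<in> V"
        using lab_outer[OF site_in, of p] outerV[of "site n m p"] site_in[of p n m] bpos_site[of p n m]
        by simp_all
      moreover have "l \<noteq> {}" using p by simp
      ultimately show "l \<in> (\<lambda>l. l) ` (lab ` V) - {{}}" by blast
    qed
  qed
  finally show "compose_diagram (tl_gen n i) (diagram_of n m f) = diagram_of n m (surgery i f)"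
    by (simp add: g_def)
  show "loops (tl_gen n i) (diagram_of n m f) = 0" if "f i \<noteq> Suc i"
  proof -
    have "outer_node -` C \<noteq> {}" if C: "C \<in> glued_components (tl_gen n i) (diagram_of n m f)" for C
    proof -
      obtain x where x: "x \<in> V" "C = {y \<in> V. lab y = lab x}" using C unfolding comp by blast
      then have l: "lab x \<in> diagram_of n m g" using labV \<open>f i \<noteq> Suc i\<close> by blast
      then have "outer_node -` C = lab x" using pre x by simp
      then show ?thesis using l by (auto simp: diagram_of_def)
    qed
    then have "{C \<in> glued_components (tl_gen n i) (diagram_of n m f). outer_node -` C = {}} = {}" by blast
    then show ?thesis unfolding loops_def by (metis card.empty)
  qed
qed

section \<open>Monic matchings and their closers\<close>

text \<open>
  Only sources are recorded: in a monic matching all targets are closers.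
\<close>

definition closers :: "nat \<Rightarrow> (nat \<Rightarrow> nat) \<Rightarrow> nat set" where
  "closers n f = {p. p < n \<and> f p < p}"

lemma monic_ncm: "f \<in> monic_matchings n m \<Longrightarrow> f \<in> nc_matchings (n + m)"
  and monic_less: "f \<in> monic_matchings n m \<Longrightarrow> n \<le> p \<Longrightarrow> p < n + m \<Longrightarrow> f p < n"
  by (simp_all add: monic_matchings_def)

lemma finite_closers [simp]: "finite (closers n f)"
  by (simp add: closers_def)

lemma monic_closers_iff:
  assumes f: "f \<in> monic_matchings n m"
  shows "f p < p \<longleftrightarrow> p \<in> closers n f \<or> n \<le> p \<and> p < n + m"
proof (cases "p < n")
  case True then show ?thesis by (simp add: closers_def)
next
  case False
  then show ?thesis
    using monic_less[OF f, of p] ncm_neq[OF monic_ncm[OF f], of p]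
    by (cases "p < n + m") (auto simp: closers_def)
qed

lemma monic_card_closers:
  assumes f: "f \<in> monic_matchings n m"
  shows "2 * (card (closers n f) + m) = n + m"
proof -
  have "{p. f p < p} = closers n f \<union> {n..<n + m}"
    by (simp only: set_eq_iff monic_closers_iff[OF f] mem_Collect_eq Un_iff atLeastLessThan_iff simp_thms)
  moreover have "card (closers n f \<union> {n..<n + m}) = card (closers n f) + card {n..<n + m}"
    by (rule card_Un_disjoint) (auto simp: closers_def)
  ultimately show ?thesis using ncm_card_closers[OF monic_ncm[OF f]] by simp
qed

text \<open>
  All monic matchings have equally many closers, so an inclusion between their sets of closers is an
  equality.
\<close>

lemma monic_eqI:
  assumes f: "f \<in> monic_matchings n m" and g: "g \<in> monic_matchings n m"
    and sub: "closers n f \<subseteq> closers n g"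
  shows "f = g"
proof -
  have "card (closers n f) = card (closers n g)"
    using monic_card_closers[OF f] monic_card_closers[OF g] by simp
  then have "closers n f = closers n g" using sub by (simp add: card_subset_eq)
  then show ?thesis
    by (intro ncm_eq_of_closers[OF monic_ncm[OF f] monic_ncm[OF g]])
      (simp only: monic_closers_iff[OF f] monic_closers_iff[OF g])
qed

text \<open>
  Nothing fits between an opener and a closer that are neighbours.
\<close>

lemma ncm_adjacent:
  assumes f: "f \<in> nc_matchings N" and "p < f p" and "f (Suc p) < Suc p"
  shows "f p = Suc p"
proof -
  have "\<not> f (Suc p) < p"
    using ncm_nested[OF f, of "f (Suc p)" p] ncm_invol[OF f, of "Suc p"] assms(2) by auto
  then have "f (Suc p) = p" using assms(3) by simp
  then show ?thesis using ncm_invol[OF f, of "Suc p"] by simp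
qed

lemma surgery_monic:
  assumes f: "f \<in> monic_matchings n m" and i: "Suc i < n" and low: "f i < n \<or> f (Suc i) < n"
  shows "surgery i f \<in> monic_matchings n m"
proof -
  note f' = monic_ncm[OF f]
  have "surgery i f p < n" if p: "n \<le> p" "p < n + m" for p
  proof (cases "f i = Suc i")
    case True
    then have "surgery i f = f" using surgery_cup ncm_invol[OF f', of i] by simp
    then show ?thesis using monic_less[OF f p] by simp
  next
    case False
    have iN: "Suc i < n + m" using i by simp
    consider "f p = i" | "f p = Suc i" | "f p \<noteq> i" "f p \<noteq> Suc i" by blast
    then show ?thesis
    proof cases
      case 1
      then have "p = f i" using ncm_invol[OF f'] by metis
      then show ?thesis using surgery_partner(1)[OF f' False iN] low p by simp
    next
      case 2
      then have "p = f (Suc i)" using ncm_invol[OF f'] by metis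
      then show ?thesis using surgery_partner(2)[OF f' False iN] low p by simp
    next
      case 3
      then show ?thesis using surgery_other[OF f', of p i] monic_less[OF f p] p i by simp
    qed
  qed
  then show ?thesis using surgery_nc_matching[OF f'] i by (simp add: monic_matchings_def)
qed

lemma surgery_not_monic:
  assumes f: "f \<in> nc_matchings (n + m)" and i: "Suc i < n" and "n \<le> f i" "n \<le> f (Suc i)"
  shows "surgery i f \<notin> monic_matchings n m"
proof
  assume g: "surgery i f \<in> monic_matchings n m"
  have "f i < n + m" using ncm_less[OF f] i by simp
  then have "surgery i f (f i) < n" using monic_less[OF g] assms(3) by blast
  moreover have "surgery i f (f i) = f (Suc i)" using surgery_partner[OF f] i assms(3) by simp
  ultimately show False using assms(4) by simp
qed

text \<open>
  The relation \<open>U\<^sub>i U\<^sub>i\<^sub>+\<^sub>1 U\<^sub>i = U\<^sub>i\<close> applied to a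
  diagram in the image of \<open>U\<^sub>i\<close>.
\<close>

lemma surgery_surgery_Suc:
  assumes f: "f \<in> nc_matchings N" and N: "Suc (Suc i) < N" and cup: "f i = Suc i"
  shows "surgery i (surgery (Suc i) f) = f"
proof -
  define b where "b = f (Suc (Suc i))"
  have fb: "f b = Suc (Suc i)" "f (Suc i) = i" using ncm_invol[OF f] cup by (metis b_def)+
  then have "b \<noteq> i" "b \<noteq> Suc i" "b \<noteq> Suc (Suc i)"
    using cup ncm_neq[OF f, of "Suc (Suc i)"] N by (auto simp: b_def)
  then show ?thesis
    using fb cup by (auto simp: fun_eq_iff surgery_def b_def[symmetric])
qed

lemma surgery_Suc_surgery:
  assumes f: "f \<in> nc_matchings N" and N: "Suc (Suc i) < N" and cup: "f (Suc i) = Suc (Suc i)"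
  shows "surgery (Suc i) (surgery i f) = f"
proof -
  define a where "a = f i"
  have fa: "f a = i" "f (Suc (Suc i)) = Suc i" using ncm_invol[OF f] cup by (metis a_def)+
  then have "a \<noteq> i" "a \<noteq> Suc i" "a \<noteq> Suc (Suc i)"
    using cup ncm_neq[OF f, of i] N by (auto simp: a_def)
  then show ?thesis
    using fa cup by (auto simp: fun_eq_iff surgery_def a_def[symmetric])
qed

section \<open>The weight of a monic matching\<close>

text \<open>
  Since the powers of 2 are super-increasing, the weight compares sets of closers at the last source
  where they differ.
\<close>

definition weight :: "nat \<Rightarrow> (nat \<Rightarrow> nat) \<Rightarrow> nat" where
  "weight n f = (\<Sum>p\<in>closers n f. 2 ^ p)"

lemma sum_replace:
  fixes w :: "'a \<Rightarrow> nat"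
  assumes "finite C" "x \<in> C" "y \<notin> C"
  shows "sum w (insert y (C - {x})) + w x = sum w C + w y"
  using assms by (simp add: sum.remove)

lemma weight_replace:
  assumes "closers n g = insert y (closers n f - {x})" "x \<in> closers n f" "y \<notin> closers n f"
  shows "weight n g + 2 ^ x = weight n f + 2 ^ y"
  unfolding weight_def assms(1) using sum_replace[OF finite_closers assms(2,3)] .

text \<open>
  The cup at \<open>Suc i\<close> slides up past the line starting at \<open>i\<close>, which moves one
  closer one step up. The generator that undoes this creates no loop.
\<close>

lemma untangle:
  assumes f: "f \<in> monic_matchings n m" and i: "Suc (Suc i) < n" and op: "i < f i" and cup: "f (Suc i) = Suc (Suc i)"
  shows "surgery i f \<in> monic_matchings n m" "weight n (surgery i f) < weight n f"
    "surgery i f (Suc i) \<noteq> Suc (Suc i)" "surgery (Suc i) (surgery i f) = f"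
proof -
  note f' = monic_ncm[OF f]
  show "surgery i f \<in> monic_matchings n m" using surgery_monic[OF f] i cup by simp
  show "surgery i f (Suc i) \<noteq> Suc (Suc i)" by simp
  show "surgery (Suc i) (surgery i f) = f" using surgery_Suc_surgery[OF f' _ cup] i by simp
  define a where "a = f i"
  have fa: "f a = i" "f (Suc (Suc i)) = Suc i" "f i = a" using ncm_invol[OF f'] cup by (metis a_def)+
  then have a: "Suc (Suc i) < a" using cup op ncm_neq[OF f', of "Suc i"] i
    by (metis Suc_lessI n_not_Suc_n)
  have "closers n (surgery i f) = insert (Suc i) (closers n f - {Suc (Suc i)})"
  proof (rule set_eqI)
    fix p
    consider "p = i" | "p = Suc i" | "p = Suc (Suc i)" | "p = a"
      | "p \<notin> {i, Suc i, Suc (Suc i), a}" by blast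
    then show "p \<in> closers n (surgery i f) \<longleftrightarrow> p \<in> insert (Suc i) (closers n f - {Suc (Suc i)})"
      using i a fa cup by cases (auto simp: closers_def surgery_def)
  qed
  from weight_replace[OF this] have "weight n (surgery i f) + 2 ^ Suc (Suc i) = weight n f + 2 ^ Suc i"
    using i cup fa by (simp add: closers_def)
  moreover have "(2::nat) ^ Suc i < 2 ^ Suc (Suc i)" by simp
  ultimately show "weight n (surgery i f) < weight n f" by linarith
qed

text \<open>
  There are three ways to obtain the cup at \<open>q\<close> by surgery, according to whether the line
  through the former partners encloses the cup, lies after it, or lies before it. In each case exactly
  one closer moves.
\<close>

lemma closers_surgery:
  assumes f: "f \<in> monic_matchings n m" and i: "Suc q < n" and ne: "f q \<noteq> Suc q"
    and low: "f q < n \<or> f (Suc q) < n"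
  shows "f q < q \<and> Suc q < f (Suc q) \<and> closers n f = insert q (closers n (surgery q f) - {Suc q})
    \<or> Suc q < f (Suc q) \<and> f (Suc q) < f q \<and> f (Suc q) < n \<and> f (Suc q) \<notin> closers n (surgery q f) \<and>
        closers n f = insert (f (Suc q)) (closers n (surgery q f) - {Suc q})
    \<or> f (Suc q) < f q \<and> f q < q \<and> f q \<in> closers n (surgery q f) \<and>
        closers n f = insert q (closers n (surgery q f) - {f q})"
proof -
  note f' = monic_ncm[OF f]
  define a b where "a = f q" and "b = f (Suc q)"
  have fa: "f a = q" "f b = Suc q" "f q = a" "f (Suc q) = b"
    using ncm_invol[OF f'] by (auto simp: a_def b_def)
  have ab: "a \<noteq> q" "b \<noteq> Suc q" "a \<noteq> Suc q" "b \<noteq> q" "a \<noteq> b"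
    using ncm_neq[OF f', of q] ncm_neq[OF f', of "Suc q"] i ne fa by auto
  have pos: "a < q \<and> Suc q < b \<or> Suc q < b \<and> b < a \<or> b < a \<and> a < q"
    using ncm_nested[OF f', of q "Suc q"] ncm_nested[OF f', of b q] ncm_nested[OF f', of a b] fa ab
      ncm_nested[OF f', of "Suc q" a]
    by (auto simp: neq_iff)
  have bn: "b < n" if "b < a" using that low fa by auto
  have aN: "a < n + m" "b < n + m" using ncm_less[OF f'] i by (auto simp: a_def b_def)
  have oth: "p \<in> closers n f \<longleftrightarrow> p \<in> closers n (surgery q f)" if "p \<notin> {q, Suc q, a, b}" for p
    using that fa by (auto simp: closers_def surgery_def)
  have sa: "surgery q f a = b" "surgery q f b = a" using ab fa by (auto simp: surgery_def)
  from pos show ?thesis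
  proof (elim disjE)
    assume h: "a < q \<and> Suc q < b"
    have "closers n f = insert q (closers n (surgery q f) - {Suc q})"
    proof (rule set_eqI)
      fix p
      consider "p \<in> {q, Suc q, a, b}" | "p \<notin> {q, Suc q, a, b}" by blast
      then show "p \<in> closers n f \<longleftrightarrow> p \<in> insert q (closers n (surgery q f) - {Suc q})"
        using oth[of p] h i ab fa sa by cases (auto simp: closers_def)
    qed
    then show ?thesis using h fa by simp
  next
    assume h: "Suc q < b \<and> b < a"
    have "closers n f = insert b (closers n (surgery q f) - {Suc q})"
    proof (rule set_eqI)
      fix p
      consider "p \<in> {q, Suc q, a, b}" | "p \<notin> {q, Suc q, a, b}" by blast
      then show "p \<in> closers n f \<longleftrightarrow> p \<in> insert b (closers n (surgery q f) - {Suc q})"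
        using oth[of p] h i ab fa sa bn by cases (auto simp: closers_def)
    qed
    moreover have "b \<notin> closers n (surgery q f)" using h sa by (simp add: closers_def)
    ultimately show ?thesis using h fa bn by simp
  next
    assume h: "b < a \<and> a < q"
    have "closers n f = insert q (closers n (surgery q f) - {a})"
    proof (rule set_eqI)
      fix p
      consider "p \<in> {q, Suc q, a, b}" | "p \<notin> {q, Suc q, a, b}" by blast
      then show "p \<in> closers n f \<longleftrightarrow> p \<in> insert q (closers n (surgery q f) - {a})"
        using oth[of p] h i ab fa sa bn by cases (auto simp: closers_def)
    qed
    moreover have "a \<in> closers n (surgery q f)" using h sa i by (simp add: closers_def)
    ultimately show ?thesis using h fa by simp
  qed
qed

text \<open>
  Let \<open>e = surgery q f\<close>, which has the closer \<open>Suc q\<close>. In \<open>f\<close>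
  this closer moves to \<open>q\<close>. Another matching with the same surgery either is
  \<open>e\<close> itself, or has the closer \<open>Suc q\<close> moved to a position after it, or keeps
  \<open>Suc q\<close> and gains \<open>q\<close> in exchange for a closer before \<open>q\<close>; all
  these are heavier than \<open>f\<close>. If it also moves \<open>Suc q\<close> to \<open>q\<close>, it
  has the closers of \<open>f\<close> and hence equals \<open>f\<close>.
\<close>

lemma surgery_fibre_weight:
  assumes f: "f \<in> monic_matchings n m" and f2: "f2 \<in> monic_matchings n m" and i: "Suc q < n"
    and opn: "f q < q" "Suc q < f (Suc q)" and eq: "surgery q f2 = surgery q f" and ne: "f2 \<noteq> f"
  shows "weight n f < weight n f2"
proof -
  let ?e = "surgery q f"
  have e: "Suc q \<in> closers n ?e" "q \<notin> closers n ?e" using i by (auto simp: closers_def)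
  have "surgery q f \<in> monic_matchings n m" using surgery_monic[OF f i] opn i by simp
  have cl: "closers n f = insert q (closers n ?e - {Suc q})"
  proof -
    have "f q \<noteq> Suc q" "f q < n" using opn i by auto
    from closers_surgery[OF f i this(1) disjI1[OF this(2)]] show ?thesis
      using opn by (elim disjE conjE) (assumption | linarith)+
  qed
  have wf: "weight n f + 2 ^ Suc q = weight n ?e + 2 ^ q" by (rule weight_replace[OF cl e])
  have q2: "(2::nat) ^ q < 2 ^ Suc q" by simp
  show ?thesis
  proof (cases "f2 q = Suc q")
    case True
    then have "f2 = ?e" using eq surgery_cup ncm_invol[OF monic_ncm[OF f2], of q] by metis
    moreover have "weight n f < weight n ?e" using wf q2 by linarith
    ultimately show ?thesis by metis
  next
    case False
    have "f2 q < n \<or> f2 (Suc q) < n"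
      using surgery_not_monic[OF monic_ncm[OF f2] i] eq \<open>surgery q f \<in> monic_matchings n m\<close> by force
    from closers_surgery[OF f2 i False this, unfolded eq] show ?thesis
    proof (elim disjE conjE)
      assume "closers n f2 = insert q (closers n ?e - {Suc q})"
      then have "f2 = f" using monic_eqI[OF f2 f] cl by simp
      then show ?thesis using ne by simp
    next
      assume h: "Suc q < f2 (Suc q)" "f2 (Suc q) \<notin> closers n ?e"
        "closers n f2 = insert (f2 (Suc q)) (closers n ?e - {Suc q})"
      have "weight n f2 + 2 ^ Suc q = weight n ?e + 2 ^ f2 (Suc q)"
        by (rule weight_replace[OF h(3) e(1) h(2)])
      moreover have "(2::nat) ^ q < 2 ^ f2 (Suc q)"
        by (rule power_strict_increasing) (use h(1) in auto)
      ultimately show ?thesis using wf by linarith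
    next
      assume h: "f2 q < q" "f2 q \<in> closers n ?e"
        "closers n f2 = insert q (closers n ?e - {f2 q})"
      have "weight n f2 + 2 ^ f2 q = weight n ?e + 2 ^ q"
        by (rule weight_replace[OF h(3) h(2) e(2)])
      moreover have "(2::nat) ^ f2 q < 2 ^ Suc q"
        by (rule power_strict_increasing) (use h(1) in auto)
      ultimately show ?thesis using wf by linarith
    qed
  qed
qed

section \<open>The untangled matching\<close>

text \<open>
  Some small cup can be slid up; in bracket notation, opener, opener, closer occur in a row.
\<close>

definition tangled :: "nat \<Rightarrow> (nat \<Rightarrow> nat) \<Rightarrow> bool" where
  "tangled n f \<longleftrightarrow> (\<exists>i. Suc (Suc i) < n \<and> i < f i \<and> f (Suc i) = Suc (Suc i))"

text \<open>
  Strip off small cups from the top as long as possible. What follows is a single source or starts with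
  two openers, and since opener, opener, closer never occurs, it consists of openers only. No closer is
  left for them among the sources, so they are joined to targets. As there is a target, at least one
  source remains.
\<close>

lemma untangled_shape:
  assumes f: "f \<in> monic_matchings n m" and m: "0 < m" and un: "\<not> tangled n f"
  obtains c where "2 * c < n" "\<And>j. j < c \<Longrightarrow> f (2 * j) = Suc (2 * j)"
    "\<And>p. 2 * c \<le> p \<Longrightarrow> p < n \<Longrightarrow> n \<le> f p"
proof -
  note f' = monic_ncm[OF f]
  let ?P = "\<lambda>c. 2 * c \<le> n \<and> (\<forall>j<c. f (2 * j) = Suc (2 * j))"
  define c where "c = (GREATEST c. ?P c)"
  have bd: "c \<le> n" if "?P c" for c using that by simp
  have Pc: "?P c" unfolding c_def by (rule GreatestI_nat[of ?P 0 n]) (use bd in auto)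
  have max: "c' \<le> c" if "?P c'" for c' unfolding c_def by (rule Greatest_le_nat[of ?P c' n]) (use bd that in auto)
  have cup: "f (2 * j) = Suc (2 * j)" "f (Suc (2 * j)) = 2 * j" if "j < c" for j
  proof -
    show *: "f (2 * j) = Suc (2 * j)" using Pc that by blast
    show "f (Suc (2 * j)) = 2 * j" using ncm_invol[OF f', of "2 * j"] * by simp
  qed
  have closed: "f p < 2 * c" if "p < 2 * c" for p
  proof -
    have j: "p div 2 < c" using that by simp
    have "p = 2 * (p div 2) \<or> p = Suc (2 * (p div 2))" by presburger
    then have "f p = Suc (2 * (p div 2)) \<or> f p = 2 * (p div 2)" using cup[OF j] by metis
    then show ?thesis using j by linarith
  qed
  have ge: "2 * c \<le> f p" if "2 * c \<le> p" for p
    using closed[of "f p"] ncm_invol[OF f', of p] that by (metis not_less)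
  have cn: "2 * c < n" using ge[of n] monic_less[OF f, of n] m Pc by simp
  have start: "2 * c < f (2 * c)" using ge[of "2 * c"] ncm_neq[OF f', of "2 * c"] cn by simp
  have op: "p < f p" if "2 * c \<le> p" "p < n" for p
    using that
  proof (induction p rule: less_induct)
    case (less p)
    have nep: "f p \<noteq> p" using ncm_neq[OF f'] less.prems by simp
    consider "p = 2 * c" | "p = Suc (2 * c)" | i where "2 * c \<le> i" "p = Suc (Suc i)"
      using less.prems by (metis le_Suc_ex add_Suc_right not0_implies_Suc add_0_right le_add1)
    then show ?case
    proof cases
      case 1 then show ?thesis using start by simp
    next
      case 2
      have "f (2 * c) \<noteq> Suc (2 * c)"
      proof
        assume "f (2 * c) = Suc (2 * c)"
        then have "?P (Suc c)" using cup less.prems 2 by (auto simp: less_Suc_eq)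
        then show False using max by fastforce
      qed
      then show ?thesis using ncm_adjacent[OF f' start] nep 2 by (metis linorder_neqE_nat)
    next
      case 3
      have "i < f i" "Suc i < f (Suc i)" using less 3 by auto
      moreover have "f (Suc i) \<noteq> Suc (Suc i)"
        using un calculation 3 less.prems by (auto simp: tangled_def)
      ultimately show ?thesis
        using ncm_adjacent[OF f', of "Suc i"] nep 3 by (metis linorder_neqE_nat)
    qed
  qed
  have "n \<le> f p" if "2 * c \<le> p" "p < n" for p
    using op[OF that] op[of "f p"] ge[OF that(1)] ncm_invol[OF f', of p] by (metis leI less_asym)
  then show thesis using that cn cup by blast
qed

lemma untangled_closers:
  assumes f: "f \<in> monic_matchings n m" and "2 * c < n" "\<And>j. j < c \<Longrightarrow> f (2 * j) = Suc (2 * j)"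
    "\<And>p. 2 * c \<le> p \<Longrightarrow> p < n \<Longrightarrow> n \<le> f p"
  shows "closers n f = {p. p < 2 * c \<and> odd p}"
proof (rule set_eqI)
  fix p
  note f' = monic_ncm[OF f]
  show "p \<in> closers n f \<longleftrightarrow> p \<in> {p. p < 2 * c \<and> odd p}"
  proof (cases "p < 2 * c")
    case True
    then have j: "p div 2 < c" by simp
    have "f (2 * (p div 2)) = Suc (2 * (p div 2))" using assms(3)[OF j] .
    moreover then have "f (Suc (2 * (p div 2))) = 2 * (p div 2)" using ncm_invol[OF f'] by metis
    moreover have "p = 2 * (p div 2) \<and> even p \<or> p = Suc (2 * (p div 2)) \<and> odd p" by presburger
    ultimately show ?thesis using True assms(2) unfolding closers_def
      by (metis (mono_tags, lifting) mem_Collect_eq lessI less_trans less_asym)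
  next
    case False
    then show ?thesis using assms(4)[of p] by (auto simp: closers_def)
  qed
qed

lemma untangled_unique:
  assumes f: "f \<in> monic_matchings n m" and g: "g \<in> monic_matchings n m" and m: "0 < m"
    and un: "\<not> tangled n f" "\<not> tangled n g"
  shows "f = g"
proof -
  obtain c where "closers n f = {p. p < 2 * c \<and> odd p}"
    using untangled_shape[OF f m un(1)] untangled_closers[OF f] by metis
  moreover obtain d where "closers n g = {p. p < 2 * d \<and> odd p}"
    using untangled_shape[OF g m un(2)] untangled_closers[OF g] by metis
  moreover have "{p. p < 2 * c \<and> odd p} \<subseteq> {p. p < 2 * d \<and> odd p}
      \<or> {p. p < 2 * d \<and> odd p} \<subseteq> {p. p < 2 * c \<and> odd p}"
    by (cases c d rule: le_cases) auto
  ultimately show ?thesis using monic_eqI[OF f g] monic_eqI[OF g f] by metis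
qed

section \<open>The leading matching\<close>

text \<open>
  After the first \<open>c\<close> cups a closer is never followed by an opener, so the closers there
  are the last sources.
\<close>

definition leading :: "nat \<Rightarrow> nat \<Rightarrow> (nat \<Rightarrow> nat) \<Rightarrow> bool" where
  "leading n c f \<longleftrightarrow> (\<forall>j<c. f (2 * j) = Suc (2 * j)) \<and>
     (\<forall>q. 2 * c \<le> q \<and> Suc q < n \<and> f q < q \<longrightarrow> f (Suc q) < Suc q)"

text \<open>
  The closers of both matchings agree on the first \<open>2c\<close> sources and are final segments of
  the rest, so one set contains the other.
\<close>

lemma leading_unique:
  assumes f: "f \<in> monic_matchings n m" and g: "g \<in> monic_matchings n m"
    and lf: "leading n c f" and lg: "leading n c g"
  shows "f = g"
proof -
  have low: "f p = g p" if "p < 2 * c" for p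
  proof -
    have j: "p div 2 < c" using that by simp
    have "f (2 * (p div 2)) = Suc (2 * (p div 2))" "g (2 * (p div 2)) = Suc (2 * (p div 2))"
      using lf lg j by (auto simp: leading_def)
    moreover then have "f (Suc (2 * (p div 2))) = 2 * (p div 2)" "g (Suc (2 * (p div 2))) = 2 * (p div 2)"
      using ncm_invol[OF monic_ncm[OF f]] ncm_invol[OF monic_ncm[OF g]] by metis+
    moreover have "p = 2 * (p div 2) \<or> p = Suc (2 * (p div 2))" by presburger
    ultimately show ?thesis by metis
  qed
  have up: "h p < p" if "leading n c h" "2 * c \<le> q" "q \<le> p" "p < n" "h q < q" for h p q
    using that(3,4)
  proof (induction p rule: dec_induct)
    case base then show ?case using that by simp
  next
    case (step p) then show ?case using that by (simp add: leading_def)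
  qed
  have "closers n f \<subseteq> closers n g \<or> closers n g \<subseteq> closers n f"
  proof (rule ccontr)
    assume "\<not> ?thesis"
    then obtain p q where p: "p < n" "f p < p" "\<not> g p < p" and q: "q < n" "g q < q" "\<not> f q < q"
      unfolding closers_def by blast
    have "2 * c \<le> p" "2 * c \<le> q" using low p q by (metis leI)+
    then show False using up[OF lf, of p q] up[OF lg, of q p] p q by (meson nat_le_linear)
  qed
  then show ?thesis using monic_eqI[OF f g] monic_eqI[OF g f] by blast
qed

section \<open>Generators acting on cell modules\<close>

definition unit_vec :: "diagram \<Rightarrow> diagram \<Rightarrow> 'r::field" where
  "unit_vec D = (\<lambda>F. if F = D then 1 else 0)"

lemma unit_vec_apply: "unit_vec D F = (if F = D then 1 else 0)"
  by (simp only: unit_vec_def)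

lemma finite_diagrams: "finite (diagrams n m)"
proof (rule finite_subset)
  show "diagrams n m \<subseteq> Pow (Pow (sites n m))"
  proof
    fix D assume "D \<in> diagrams n m"
    then have "\<Union> D = sites n m" by (simp only: diagrams_def partition_on_def mem_Collect_eq)
    then show "D \<in> Pow (Pow (sites n m))" by blast
  qed
  show "finite (Pow (Pow (sites n m)))" by (simp add: sites_def)
qed

lemma monic_diagrams_subset: "monic_diagrams n m \<subseteq> diagrams n m"
  unfolding monic_diagrams_def by blast

lemma diagram_of_monic: "f \<in> monic_matchings n m \<Longrightarrow> diagram_of n m f \<in> monic_diagrams n m"
  by (simp add: monic_diagrams_eq)

lemma diagram_of_eq_iff:
  "f \<in> monic_matchings n m \<Longrightarrow> g \<in> monic_matchings n m \<Longrightarrow> diagram_of n m f = diagram_of n m g \<longleftrightarrow> f = g"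
  using diagram_of_inj[of n m] monic_ncm by (metis inj_onD)

lemma inj_on_diagram_of_monic: "inj_on (diagram_of n m) (monic_matchings n m)"
  by (rule inj_on_subset[OF diagram_of_inj]) (use monic_ncm in blast)

lemma finite_monic: "finite (monic_matchings n m)"
proof (rule finite_imageD[OF _ inj_on_diagram_of_monic])
  show "finite (diagram_of n m ` monic_matchings n m)"
    unfolding monic_diagrams_eq[symmetric]
    by (rule finite_subset[OF monic_diagrams_subset finite_diagrams])
qed

lemma unit_vec_cell_module: "f \<in> monic_matchings n m \<Longrightarrow> unit_vec (diagram_of n m f) \<in> cell_module n m"
  using diagram_of_monic by (fastforce simp: cell_module_def free_on_def unit_vec_def)

lemma cell_module_eqI:
  assumes x: "x \<in> cell_module n m" and y: "y \<in> cell_module n m"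
    and eq: "\<And>f. f \<in> monic_matchings n m \<Longrightarrow> x (diagram_of n m f) = y (diagram_of n m f)"
  shows "x = y"
proof
  fix D
  show "x D = y D"
  proof (cases "D \<in> monic_diagrams n m")
    case True then show ?thesis using eq by (auto simp: monic_diagrams_eq)
  next
    case False then show ?thesis using x y by (simp add: cell_module_def free_on_def)
  qed
qed

lemma zero_cell_module: "0 \<in> cell_module n m"
  by (simp add: cell_module_def free_on_def)

lemma cell_act_cell_module: "cell_act \<delta> n m a x \<in> cell_module n m"
  by (simp add: cell_act_def cell_module_def free_on_def)

definition gen_act :: "'r::field \<Rightarrow> nat \<Rightarrow> nat \<Rightarrow> nat \<Rightarrow> (diagram \<Rightarrow> 'r) \<Rightarrow> diagram \<Rightarrow> 'r" where
  "gen_act \<delta> n m i x = cell_act \<delta> n m (unit_vec (tl_gen n i)) x"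

lemma unit_vec_TL: "Suc i < n \<Longrightarrow> unit_vec (tl_gen n i) \<in> TL n"
  using tl_gen_in_diagrams by (fastforce simp: TL_def dhom_def free_on_def unit_vec_def)

text \<open>
  Surgery turns the action of a generator into a sum over a fibre, with a power of
  \<open>\<delta>\<close> that matters only for matchings which contain the cup already.
\<close>

lemma gen_act_coeff:
  fixes \<delta> :: "'r::field"
  assumes i: "Suc i < n" and x: "x \<in> cell_module n m" and f: "f \<in> monic_matchings n m"
  shows "gen_act \<delta> n m i x (diagram_of n m f) =
    (\<Sum>g\<in>monic_matchings n m.
      if surgery i g = f then x (diagram_of n m g) * \<delta> ^ loops (tl_gen n i) (diagram_of n m g) else 0)"
proof -
  let ?U = "tl_gen n i" and ?F = "diagram_of n m f"
  define h where "h E = (if compose_diagram ?U E = ?F then x E * \<delta> ^ loops ?U E else 0)" for E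
  have "gen_act \<delta> n m i x ?F = (\<Sum>D\<in>diagrams n n. \<Sum>E\<in>diagrams n m.
      if compose_diagram D E = ?F then unit_vec ?U D * x E * \<delta> ^ loops D E else 0)"
    using diagram_of_monic[OF f] by (simp add: gen_act_def cell_act_def compose_def)
  also have "\<dots> = (\<Sum>D\<in>diagrams n n. if D = ?U then \<Sum>E\<in>diagrams n m. h E else 0)"
  proof (intro sum.cong refl)
    fix D
    show "(\<Sum>E\<in>diagrams n m. if compose_diagram D E = ?F then unit_vec ?U D * x E * \<delta> ^ loops D E else 0)
        = (if D = ?U then \<Sum>E\<in>diagrams n m. h E else 0)"
    proof (cases "D = ?U")
      case True then show ?thesis by (auto simp: h_def unit_vec_apply intro!: sum.cong)
    next
      case False
      then have "unit_vec ?U D = (0 :: 'r)" by (simp only: unit_vec_def if_False)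
      then show ?thesis using False by (simp only: mult_zero_left if_cancel sum.neutral_const if_False)
    qed
  qed
  also have "\<dots> = (\<Sum>E\<in>diagrams n m. h E)"
    using tl_gen_in_diagrams[OF i] by (simp add: finite_diagrams)
  also have "\<dots> = (\<Sum>E\<in>monic_diagrams n m. h E)"
    using x by (intro sum.mono_neutral_right finite_diagrams monic_diagrams_subset)
      (simp add: h_def cell_module_def free_on_def)
  also have "\<dots> = (\<Sum>g\<in>monic_matchings n m. h (diagram_of n m g))"
    unfolding monic_diagrams_eq by (simp add: sum.reindex[OF inj_on_diagram_of_monic])
  also have "\<dots> = (\<Sum>g\<in>monic_matchings n m.
      if surgery i g = f then x (diagram_of n m g) * \<delta> ^ loops ?U (diagram_of n m g) else 0)"
  proof (intro sum.cong refl)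
    fix g assume g: "g \<in> monic_matchings n m"
    have "surgery i g \<in> nc_matchings (n + m)" using surgery_nc_matching[OF monic_ncm[OF g]] i by simp
    then have "diagram_of n m (surgery i g) = ?F \<longleftrightarrow> surgery i g = f"
      using diagram_of_inj[of n m] monic_ncm[OF f] by (metis inj_onD)
    then show "h (diagram_of n m g) =
        (if surgery i g = f then x (diagram_of n m g) * \<delta> ^ loops ?U (diagram_of n m g) else 0)"
      unfolding h_def compose_tl_gen(1)[OF monic_ncm[OF g] i] by simp
  qed
  finally show ?thesis .
qed

lemma gen_act_zero: "gen_act \<delta> n m i 0 = 0"
  using cell_act_add[of \<delta> n m "unit_vec (tl_gen n i)" 0 0] by (simp add: gen_act_def)

lemma gen_act_cell_module: "gen_act \<delta> n m i x \<in> cell_module n m"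
  by (simp add: gen_act_def cell_act_cell_module)

lemma gen_act_support:
  assumes i: "Suc i < n" and x: "x \<in> cell_module n m" and f: "f \<in> monic_matchings n m"
    and nz: "gen_act \<delta> n m i x (diagram_of n m f) \<noteq> 0"
  shows "f i = Suc i"
proof -
  have "\<exists>g\<in>monic_matchings n m. surgery i g = f"
  proof (rule ccontr)
    assume "\<not> ?thesis"
    then have "gen_act \<delta> n m i x (diagram_of n m f) = 0"
      unfolding gen_act_coeff[OF i x f] by (intro sum.neutral ballI if_not_P) blast
    then show False using nz by contradiction
  qed
  then show ?thesis using surgery_simps(1) by blast
qed

lemma gen_act_unit_vec:
  assumes i: "Suc i < n" and g: "g \<in> monic_matchings n m" and ne: "g i \<noteq> Suc i"
  shows "surgery i g \<in> monic_matchings n m \<Longrightarrow>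
      gen_act \<delta> n m i (unit_vec (diagram_of n m g)) = unit_vec (diagram_of n m (surgery i g))"
    and "surgery i g \<notin> monic_matchings n m \<Longrightarrow> gen_act \<delta> n m i (unit_vec (diagram_of n m g)) = 0"
proof -
  have coeff: "gen_act \<delta> n m i (unit_vec (diagram_of n m g)) (diagram_of n m f) =
      (if surgery i g = f then 1 else 0)"
    if f: "f \<in> monic_matchings n m" for f
  proof -
    have "gen_act \<delta> n m i (unit_vec (diagram_of n m g)) (diagram_of n m f) =
      (\<Sum>h\<in>monic_matchings n m. if h = g then if surgery i g = f then 1 else 0 else 0)"
      unfolding gen_act_coeff[OF i unit_vec_cell_module[OF g] f]
      using compose_tl_gen(2)[OF monic_ncm[OF g] i ne] g
      by (intro sum.cong refl) (auto simp: unit_vec_def diagram_of_eq_iff)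
    then show ?thesis using g by (simp add: finite_monic)
  qed
  show "gen_act \<delta> n m i (unit_vec (diagram_of n m g)) = unit_vec (diagram_of n m (surgery i g))"
    if "surgery i g \<in> monic_matchings n m"
    using that by (intro cell_module_eqI[OF gen_act_cell_module unit_vec_cell_module])
      (simp_all add: coeff unit_vec_apply diagram_of_eq_iff)
  show "gen_act \<delta> n m i (unit_vec (diagram_of n m g)) = 0" if "surgery i g \<notin> monic_matchings n m"
    using that by (intro cell_module_eqI[OF gen_act_cell_module zero_cell_module]) (auto simp: coeff)
qed

text \<open>
  The witness is the heaviest matching in the support of \<open>v\<close>.
\<close>

lemma killed_leading:
  assumes v: "v \<in> cell_module n m" and nz: "v \<noteq> 0"
    and cups: "\<And>f j. f \<in> monic_matchings n m \<Longrightarrow> v (diagram_of n m f) \<noteq> 0 \<Longrightarrow> j < c \<Longrightarrow> f (2 * j) = Suc (2 * j)"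
    and killed: "\<And>q. 2 * c \<le> q \<Longrightarrow> Suc q < n \<Longrightarrow> gen_act \<delta> n m q v = 0"
  shows "\<exists>f\<in>monic_matchings n m. leading n c f \<and> v (diagram_of n m f) \<noteq> 0"
proof -
  let ?S = "{f \<in> monic_matchings n m. v (diagram_of n m f) \<noteq> 0}"
  have fin: "finite ?S" using finite_monic by simp
  have ne: "?S \<noteq> {}" using cell_module_eqI[OF v zero_cell_module] nz by fastforce
  obtain f where f: "f \<in> ?S" and max: "Max (weight n ` ?S) = weight n f"
    by (rule obtains_MAX[OF fin ne, of "weight n"])
  have max: "weight n g \<le> weight n f" if "g \<in> ?S" for g
    unfolding max[symmetric] by (rule Max_ge[OF finite_imageI[OF fin] imageI[OF that]])
  have fm: "f \<in> monic_matchings n m" using f by simp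
  have "f (Suc q) < Suc q" if q: "2 * c \<le> q" "Suc q < n" "f q < q" for q
  proof (rule ccontr)
    assume "\<not> f (Suc q) < Suc q"
    then have op: "Suc q < f (Suc q)"
      using ncm_neq[OF monic_ncm[OF fm], of "Suc q"] q by simp
    have e: "surgery q f \<in> monic_matchings n m" using surgery_monic[OF fm q(2)] q by simp
    \<comment> \<open>the rest of the fibre is heavier than \<open>f\<close> and so lies outside the support\<close>
    have "v (diagram_of n m g) = 0" if "g \<in> monic_matchings n m" "surgery q g = surgery q f" "g \<noteq> f" for g
      using surgery_fibre_weight[OF fm that(1) q(2,3) op that(2,3)] max[of g] that(1)
      by (metis (mono_tags, lifting) mem_Collect_eq not_less)
    then have "gen_act \<delta> n m q v (diagram_of n m (surgery q f)) =
        (\<Sum>g\<in>monic_matchings n m. if g = f then v (diagram_of n m f) else 0)"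
      unfolding gen_act_coeff[OF q(2) v e]
      using compose_tl_gen(2)[OF monic_ncm[OF fm] q(2)] q(3)
      by (intro sum.cong refl) auto
    also have "\<dots> = v (diagram_of n m f)" using fm by (simp add: finite_monic)
    finally show False using killed[OF q(1,2)] f by simp
  qed
  then show ?thesis using f cups by (auto simp: leading_def)
qed

section \<open>Homomorphisms of cell modules\<close>

lemma cell_homD:
  assumes "\<phi> \<in> cell_hom \<delta> n r s"
  shows "x \<in> cell_module n r \<Longrightarrow> \<phi> x \<in> cell_module n s"
    and "x \<in> cell_module n r \<Longrightarrow> y \<in> cell_module n r \<Longrightarrow> \<phi> (x + y) = \<phi> x + \<phi> y"
    and "x \<in> cell_module n r \<Longrightarrow> \<phi> (scale c x) = scale c (\<phi> x)"
    and "x \<in> cell_module n r \<Longrightarrow> Suc i < n \<Longrightarrow> \<phi> (gen_act \<delta> n r i x) = gen_act \<delta> n s i (\<phi> x)"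
    and "x \<notin> cell_module n r \<Longrightarrow> \<phi> x = 0"
    and "\<phi> 0 = 0"
proof -
  show add: "x \<in> cell_module n r \<Longrightarrow> y \<in> cell_module n r \<Longrightarrow> \<phi> (x + y) = \<phi> x + \<phi> y" for x y
    using assms unfolding cell_hom_def by blast
  show "x \<in> cell_module n r \<Longrightarrow> Suc i < n \<Longrightarrow> \<phi> (gen_act \<delta> n r i x) = gen_act \<delta> n s i (\<phi> x)"
    using assms unit_vec_TL[of i n] unfolding cell_hom_def gen_act_def by blast
  show "\<phi> 0 = 0" using add[OF zero_cell_module zero_cell_module] by simp
qed (use assms in \<open>unfold cell_hom_def, blast+\<close>)

lemma cell_hom_eq_0I:
  assumes \<phi>: "\<phi> \<in> cell_hom \<delta> n r s"
    and zero: "\<And>f. f \<in> monic_matchings n r \<Longrightarrow> \<phi> (unit_vec (diagram_of n r f)) = 0"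
  shows "\<phi> = 0"
proof
  fix x
  have "\<phi> x = 0" if "finite A" "A \<subseteq> monic_diagrams n r" "x \<in> free_on A" for A x
    using that
  proof (induction A arbitrary: x rule: finite_induct)
    case empty
    then have "x = 0" by (auto simp: free_on_def fun_eq_iff)
    then show ?case using cell_homD(6)[OF \<phi>] by (simp only:)
  next
    case (insert D A)
    obtain f where f: "f \<in> monic_matchings n r" "D = diagram_of n r f"
      using insert.prems by (auto simp: monic_diagrams_eq)
    let ?y = "x(D := 0)"
    have y: "?y \<in> free_on A" using insert.prems by (auto simp: free_on_def)
    then have y': "?y \<in> cell_module n r" using insert.prems by (auto simp: free_on_def cell_module_def)
    have u: "unit_vec D \<in> cell_module n r" using unit_vec_cell_module f by simp
    then have cu: "scale (x D) (unit_vec D) \<in> cell_module n r"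
      by (auto simp: cell_module_def free_on_def scale_def)
    have "x = ?y + scale (x D) (unit_vec D)" by (auto simp: fun_eq_iff scale_def unit_vec_def)
    then have "\<phi> x = \<phi> ?y + scale (x D) (\<phi> (unit_vec D))"
      using cell_homD(2)[OF \<phi> y' cu] cell_homD(3)[OF \<phi> u] by metis
    also have "\<phi> ?y = 0" by (rule insert.IH[OF _ y]) (use insert.prems in blast)
    also have "\<phi> (unit_vec D) = 0" unfolding f(2) by (rule zero[OF f(1)])
    also have "0 + scale (x D) 0 = 0" by (simp add: scale_def fun_eq_iff)
    finally show ?case .
  qed
  from this[OF finite_subset[OF monic_diagrams_subset finite_diagrams] subset_refl, of x]
  show "\<phi> x = 0 x" using cell_homD(5)[OF \<phi>, of x] by (auto simp: cell_module_def)
qed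

text \<open>
  By induction on the weight: a tangled matching is obtained by a generator from a lighter one.
\<close>

lemma cell_hom_determined:
  assumes \<phi>: "\<phi> \<in> cell_hom \<delta> n r s" and r: "0 < r"
    and e: "e \<in> monic_matchings n r" "\<not> tangled n e" and zero: "\<phi> (unit_vec (diagram_of n r e)) = 0"
  shows "\<phi> = 0"
proof (rule cell_hom_eq_0I[OF \<phi>])
  fix f assume "f \<in> monic_matchings n r"
  then show "\<phi> (unit_vec (diagram_of n r f)) = 0"
  proof (induction "weight n f" arbitrary: f rule: less_induct)
    case less
    show ?case
    proof (cases "tangled n f")
      case False
      then show ?thesis using untangled_unique[OF e(1) less.prems r e(2)] zero by simp
    next
      case True
      then obtain i where i: "Suc (Suc i) < n" "i < f i" "f (Suc i) = Suc (Suc i)"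
        by (auto simp: tangled_def)
      note u = untangle[OF less.prems i]
      have "gen_act \<delta> n r (Suc i) (unit_vec (diagram_of n r (surgery i f))) = unit_vec (diagram_of n r f)"
        using gen_act_unit_vec(1)[OF i(1) u(1,3)] u(4) less.prems by simp
      then have "\<phi> (unit_vec (diagram_of n r f)) =
          gen_act \<delta> n s (Suc i) (\<phi> (unit_vec (diagram_of n r (surgery i f))))"
        using cell_homD(4)[OF \<phi> unit_vec_cell_module[OF u(1)] i(1)] by simp
      also have "\<phi> (unit_vec (diagram_of n r (surgery i f))) = 0" by (rule less.hyps[OF u(2,1)])
      also have "gen_act \<delta> n s (Suc i) 0 = 0"
        by (rule gen_act_zero)
      finally show ?thesis .
    qed
  qed
qed

text \<open>
  The relations \<open>U\<^sub>2\<^sub>j U\<^sub>2\<^sub>j\<^sub>+\<^sub>1 e = e\<close> and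
  \<open>U\<^sub>q e = 0\<close> are transported by \<open>\<phi>\<close> and put
  \<open>\<phi> e\<close> within the reach of the previous analysis of vectors killed by generators.
\<close>

lemma cell_hom_leading:
  assumes \<phi>: "\<phi> \<in> cell_hom \<delta> n r s" and r: "0 < r" and nz: "\<phi> \<noteq> 0"
    and e: "e \<in> monic_matchings n r" "\<not> tangled n e"
    and c: "2 * c < n" "\<And>j. j < c \<Longrightarrow> e (2 * j) = Suc (2 * j)"
      "\<And>p. 2 * c \<le> p \<Longrightarrow> p < n \<Longrightarrow> n \<le> e p"
  shows "\<exists>f\<in>monic_matchings n s. leading n c f \<and> \<phi> (unit_vec (diagram_of n r e)) (diagram_of n s f) \<noteq> 0"
proof (rule killed_leading)
  let ?x = "unit_vec (diagram_of n r e)"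
  have x: "?x \<in> cell_module n r" by (rule unit_vec_cell_module[OF e(1)])
  note e' = monic_ncm[OF e(1)]
  show v: "\<phi> ?x \<in> cell_module n s" by (rule cell_homD(1)[OF \<phi> x])
  show "\<phi> ?x \<noteq> 0" using cell_hom_determined[OF \<phi> r e] nz by blast
  show "gen_act \<delta> n s q (\<phi> ?x) = 0" if q: "2 * c \<le> q" "Suc q < n" for q
  proof -
    have "n \<le> e q" "n \<le> e (Suc q)" using c(3) q by auto
    then have "gen_act \<delta> n r q ?x = 0"
      using gen_act_unit_vec(2)[OF q(2) e(1)] surgery_not_monic[OF e' q(2)] q(2) by simp
    then show ?thesis using cell_homD(4)[OF \<phi> x q(2)] cell_homD(6)[OF \<phi>] by simp
  qed
  show "f (2 * j) = Suc (2 * j)" if f: "f \<in> monic_matchings n s" "\<phi> ?x (diagram_of n s f) \<noteq> 0" and j: "j < c" for f j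
  proof -
    let ?i = "2 * j"
    let ?g = "surgery (Suc (2 * j)) e"
    have i: "Suc ?i < n" "Suc (Suc ?i) < n" using j c(1) by auto
    have cup: "e ?i = Suc ?i" "e (Suc ?i) = ?i" using c(2)[OF j] ncm_invol[OF e', of ?i] by auto
    have g: "?g \<in> monic_matchings n r" using surgery_monic[OF e(1) i(2)] cup i by simp
    have regain: "surgery ?i ?g = e" using surgery_surgery_Suc[OF e' _ cup(1)] i by simp
    have ne: "?g ?i \<noteq> Suc ?i"
    proof
      assume "?g ?i = Suc ?i"
      moreover have "?g (Suc ?i) = Suc (Suc ?i)" by simp
      ultimately show False using ncm_invol[OF monic_ncm[OF g], of ?i] by simp
    qed
    have "gen_act \<delta> n r (Suc ?i) ?x = unit_vec (diagram_of n r ?g)"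
      using gen_act_unit_vec(1)[OF i(2) e(1) _ g] cup by simp
    moreover have "gen_act \<delta> n r ?i (unit_vec (diagram_of n r ?g)) = ?x"
      using gen_act_unit_vec(1)[OF i(1) g ne] regain e by simp
    ultimately have "gen_act \<delta> n s ?i (gen_act \<delta> n s (Suc ?i) (\<phi> ?x)) = \<phi> ?x"
      using cell_homD(4)[OF \<phi> x i(2)] cell_homD(4)[OF \<phi> unit_vec_cell_module[OF g] i(1)] by simp
    then show ?thesis using gen_act_support[OF i(1) gen_act_cell_module f(1)] f(2) by metis
  qed
qed

theorem corollary7p6:
  fixes \<delta> :: "'r::field" and n r s :: nat
  assumes "n \<ge> r" and "r > s" and "even n = even r" and "even r = even s"
  shows "(\<exists>B. finite B \<and> hom_vs.span B = cell_hom \<delta> n r s) \<and>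
         hom_vs.dim (cell_hom \<delta> n r s) \<le> 1"
proof -
  have r: "0 < r" using \<open>r > s\<close> by simp
  have sub: "hom_vs.subspace (cell_hom \<delta> n r s)" by (rule subspace_cell_hom)
  have "\<exists>\<psi>. cell_hom \<delta> n r s \<subseteq> hom_vs.span {\<psi>} \<and> \<psi> \<in> cell_hom \<delta> n r s"
  proof (cases "\<exists>\<psi>\<in>cell_hom \<delta> n r s. \<psi> \<noteq> 0")
    case False
    then have "cell_hom \<delta> n r s \<subseteq> hom_vs.span {0}"
      using hom_vs.span_zero[of "{0}"] by (metis subsetI)
    then show ?thesis using hom_vs.subspace_0[OF sub] by blast
  next
    case True
    then obtain \<psi> where \<psi>: "\<psi> \<in> cell_hom \<delta> n r s" "\<psi> \<noteq> 0" by blast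
    obtain f0 where "f0 \<in> monic_matchings n r" using cell_hom_eq_0I[OF \<psi>(1)] \<psi>(2) by blast
    \<comment> \<open>a lightest matching is untangled, since untangling makes it lighter\<close>
    then obtain e where e: "e \<in> monic_matchings n r" and
        min: "\<And>f. f \<in> monic_matchings n r \<Longrightarrow> weight n e \<le> weight n f"
      using ex_has_least_nat[of "\<lambda>f. f \<in> monic_matchings n r" f0 "weight n"] by blast
    have un: "\<not> tangled n e"
    proof
      assume "tangled n e"
      then obtain i where "Suc (Suc i) < n" "i < e i" "e (Suc i) = Suc (Suc i)"
        by (auto simp: tangled_def)
      from untangle(1,2)[OF e this] show False using min by fastforce
    qed
    obtain c where c: "2 * c < n" "\<And>j. j < c \<Longrightarrow> e (2 * j) = Suc (2 * j)"
        "\<And>p. 2 * c \<le> p \<Longrightarrow> p < n \<Longrightarrow> n \<le> e p"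
      using untangled_shape[OF e r un] by blast
    let ?x = "unit_vec (diagram_of n r e)"
    obtain f where f: "f \<in> monic_matchings n s" "leading n c f" "\<psi> ?x (diagram_of n s f) \<noteq> 0"
      using cell_hom_leading[OF \<psi>(1) r \<psi>(2) e un c] by blast
    have "\<phi> \<in> hom_vs.span {\<psi>}" if \<phi>: "\<phi> \<in> cell_hom \<delta> n r s" for \<phi>
    proof -
      define t where "t = \<phi> ?x (diagram_of n s f) / \<psi> ?x (diagram_of n s f)"
      let ?\<chi> = "\<phi> - hom_scale t \<psi>"
      have \<chi>: "?\<chi> \<in> cell_hom \<delta> n r s"
        by (rule hom_vs.subspace_diff[OF sub \<phi> hom_vs.subspace_scale[OF sub \<psi>(1)]])
      have "?\<chi> ?x (diagram_of n s f) = 0" using f(3) by (simp add: t_def hom_scale_def scale_def)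
      then have "?\<chi> = 0"
        using cell_hom_leading[OF \<chi> r _ e un c] leading_unique[OF f(1) _ f(2)] by metis
      then have "\<phi> = hom_scale t \<psi>" by simp
      then show ?thesis by (simp add: hom_vs.span_base hom_vs.span_scale)
    qed
    then show ?thesis using \<psi>(1) by blast
  qed
  then obtain \<psi> where \<psi>: "cell_hom \<delta> n r s \<subseteq> hom_vs.span {\<psi>}" "\<psi> \<in> cell_hom \<delta> n r s" by blast
  have "hom_vs.span {\<psi>} = cell_hom \<delta> n r s"
    using \<psi> hom_vs.span_minimal[OF _ sub, of "{\<psi>}"] by blast
  moreover have "hom_vs.dim (cell_hom \<delta> n r s) \<le> 1"
    using hom_vs.dim_le_card[OF \<psi>(1)] by simp
  ultimately show ?thesis by blast
qed

end
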